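(* For $n\ge2$, the pairs of statistics $(inv_D,nmin_D)$ and $(sor_D,\tilde l_D')$ are equidistributed over $D_n$, and $$\sum_{\sigma\in D_n}q^{inv_D(\sigma)}t^{nmin_D(\sigma)}=\sum_{\sigma\in D_n}q^{sor_D(\sigma)}t^{\tilde l_D'(\sigma)}=\prod_{r=1}^{n-1}\bigl(1+q^rt+qt\,[2r]_q\bigr).$$
   Context: $B_n$ is the group of bijections $\sigma$ of $\{\pm1,\ldots,\pm n\}$ with $\sigma(-i)=-\sigma(i)$, written $\sigma_1\cdots\sigma_n$ with $\sigma_i=\sigma(i)$ and with composition as product; $D_n$ is its subgroup of elements with an even number of negative entries $\sigma_i$. $[m]_q=1+q+\cdots+q^{m-1}$. $inv_D(\sigma)=|\{(i,j):1\le i<j\le n,\sigma_i>\sigma_j\}|+|\{(i,j):1\le i<j\le n,-\sigma_i>\sigma_j\}|$. $nmin_D(\sigma)=|\{i:\sigma_i>|\sigma_j|\text{ for some }j>i\}|+|\{i:\sigma_i<-1\}|$. Reflections: for $1\le i<j\le n$, $(i,j)$ exchanges $i,j$ and exchanges $-i,-j$; $(-i,j)$ exchanges $-i,j$ and exchanges $i,-j$; for $1\le j\le n$, $(-j,j)$ exchanges $j$ and $-j$ (all other points fixed). $T^B$ is the set of all these. Every $\sigma\in D_n$ factors uniquely as $(i_1,j_1)\cdots(i_k,j_k)$ with factors in $T^B$ and $0<j_1<\cdots<j_k\le n$, and $sor_D(\sigma)=\sum_{r=1}^k(j_r-i_r-2\chi(i_r<0))$, $\chi$ the indicator. Let $t_{ij}=(i,j)$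 for $1\le|i|<j\le n$, $t_{-i,i}=(-i,i)(-1,1)$ for $1<i\le n$, and $T^D=\{t_{ij}:1\le|i|<j\le n\}\cup\{t_{-i,i}:1<i\le n\}$. $\tilde l_D'(\sigma)$ is the minimal number of elements of $T^D$ whose product is $\sigma$. *)

theory Defs
  imports Complex_Main "HOL-Combinatorics.Permutations"
begin

section \<open>Signed permutations\<close>

text \<open>
  A signed permutation is a function on all integers that permutes \<open>{\<plusminus>1, \<dots>, \<plusminus>n}\<close> in the sense
  of \<^const>\<open>permutes\<close>, i.e. it fixes every other integer; so equal signed permutations are equal
  functions and the group product is \<^const>\<open>comp\<close>: \<open>(\<sigma> \<circ> \<tau>) i = \<sigma> (\<tau> i)\<close>.
\<close>

definition signed_points :: "nat \<Rightarrow> int set" where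
  "signed_points n = {- int n..int n} - {0}"

definition B_group :: "nat \<Rightarrow> (int \<Rightarrow> int) set" where
  "B_group n = {\<sigma>. \<sigma> permutes signed_points n \<and> (\<forall>i \<in> signed_points n. \<sigma> (- i) = - \<sigma> i)}"

definition D_group :: "nat \<Rightarrow> (int \<Rightarrow> int) set" where
  "D_group n = {\<sigma> \<in> B_group n. even (card {i \<in> {1..int n}. \<sigma> i < 0})}"

definition prod_comp :: "('a \<Rightarrow> 'a) list \<Rightarrow> 'a \<Rightarrow> 'a" where
  "prod_comp fs = foldr (\<circ>) fs id"


section \<open>Inversions and \<open>nmin\<close>\<close>

definition inv_D :: "nat \<Rightarrow> (int \<Rightarrow> int) \<Rightarrow> nat" where
  "inv_D n \<sigma> =
     card {(i, j). 1 \<le> i \<and> i < j \<and> j \<le> int n \<and> \<sigma> i > \<sigma> j} +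
     card {(i, j). 1 \<le> i \<and> i < j \<and> j \<le> int n \<and> - \<sigma> i > \<sigma> j}"

definition nmin_D :: "nat \<Rightarrow> (int \<Rightarrow> int) \<Rightarrow> nat" where
  "nmin_D n \<sigma> =
     card {i \<in> {1..int n}. \<exists>j \<in> {1..int n}. j > i \<and> \<sigma> i > \<bar>\<sigma> j\<bar>} +
     card {i \<in> {1..int n}. \<sigma> i < - 1}"


section \<open>Reflections and the sorting index\<close>

text \<open>
  \<open>reflection i j\<close> exchanges \<open>i\<close> with \<open>j\<close> and \<open>-i\<close> with \<open>-j\<close>; for \<open>i = -j\<close> both exchanges coincide
  and it is the sign change at \<open>j\<close>.
\<close>

definition reflection :: "int \<Rightarrow> int \<Rightarrow> int \<Rightarrow> int" where
  "reflection i j x =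
     (if x = i then j else if x = j then i
      else if x = - i then - j else if x = - j then - i else x)"

text \<open>
  The labels \<open>(i, j)\<close> of the type B reflections: \<open>1 \<le> \<bar>i\<bar> < j \<le> n\<close>, or \<open>i = -j\<close> with \<open>1 \<le> j \<le> n\<close>.
  Each reflection has exactly one such label.
\<close>

definition TB_labels :: "nat \<Rightarrow> (int \<times> int) set" where
  "TB_labels n =
     {(i, j). 1 \<le> \<bar>i\<bar> \<and> \<bar>i\<bar> < j \<and> j \<le> int n} \<union> {(- j, j) | j. 1 \<le> j \<and> j \<le> int n}"

definition sorting_factorization :: "nat \<Rightarrow> (int \<Rightarrow> int) \<Rightarrow> (int \<times> int) list \<Rightarrow> bool" where
  "sorting_factorization n \<sigma> ps \<longleftrightarrow>
     set ps \<subseteq> TB_labels n \<and> sorted_wrt (<) (map snd ps) \<and>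
     prod_comp (map (\<lambda>(i, j). reflection i j) ps) = \<sigma>"

text \<open>
  The factorization exists and is unique for every signed permutation, so the description below
  denotes it. Each summand is nonnegative on \<^const>\<open>TB_labels\<close> (for \<open>i < 0\<close> it is \<open>j + \<bar>i\<bar> - 2\<close>),
  so \<^const>\<open>nat\<close> does not truncate.
\<close>

definition sor_D :: "nat \<Rightarrow> (int \<Rightarrow> int) \<Rightarrow> nat" where
  "sor_D n \<sigma> =
     nat (\<Sum>(i, j) \<leftarrow> (THE ps. sorting_factorization n \<sigma> ps). j - i - 2 * of_bool (i < 0))"


section \<open>Type D reflection length\<close>

definition T_D :: "nat \<Rightarrow> (int \<Rightarrow> int) set" where
  "T_D n =
     {reflection i j | i j. 1 \<le> \<bar>i\<bar> \<and> \<bar>i\<bar> < j \<and> j \<le> int n} \<union>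
     {reflection (- i) i \<circ> reflection (- 1) 1 | i. 1 < i \<and> i \<le> int n}"

definition length_D :: "nat \<Rightarrow> (int \<Rightarrow> int) \<Rightarrow> nat" where
  "length_D n \<sigma> = (LEAST k. \<exists>ts. length ts = k \<and> set ts \<subseteq> T_D n \<and> prod_comp ts = \<sigma>)"


section \<open>\<open>q\<close>-integers and equidistribution\<close>

definition q_int :: "nat \<Rightarrow> 'a::comm_ring_1 \<Rightarrow> 'a" where
  "q_int m q = (\<Sum>k<m. q ^ k)"

definition equidistributed_on :: "'a set \<Rightarrow> ('a \<Rightarrow> 'b) \<Rightarrow> ('a \<Rightarrow> 'b) \<Rightarrow> bool" where
  "equidistributed_on A f g \<longleftrightarrow> (\<forall>v. card {x \<in> A. f x = v} = card {x \<in> A. g x = v})"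

end

(*
  All four statistics extend to B_n and are unchanged when the sign of the letter of absolute
  value 1 is switched, so B_n modulo this switch can be used in place of D_n. An element of B_(n+1)
  is determined by the preimage x of n+1 and an element of B_n. Building it by inserting the letter
  n+1 adds to (inv, nmin), and building it by the reflection (x, n+1) adds to (sor, length), the same
  amount: n+1-x for x > 0, n-1-x for x < 0, and 1 in the second component unless x = n+1.
  Hence both pairs satisfy the same recursion, in which the sum over x is the factor of index r = n
  of the product.
*)
theory Submission
  imports Defs
begin

section \<open>The hyperoctahedral group\<close>

text \<open>The passage through B_n is forced by parity: inserting a negative n+1, or multiplying by
  the sign change at n+1, leaves the even subgroup. The sign change at 1 repairs the parity. It
  multiplies on the left, while both constructions multiply on the right, so the repair never
  interferes with the position x. The length does not extend to B_n by its own definition, since an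
  odd element has no factorization into \<open>T_D\<close>. What extends is a weighted number of
  factors of the sorting factorization, the sign change at 1 having weight 0. That this number is
  the length on D_n is the only step beyond bookkeeping: one element of \<open>T_D\<close> raises it
  by at most 1, and conversely each even sorting factorization can be rewritten over
  \<open>T_D\<close> without exceeding it. The recursion is stated for sums of an arbitrary function
  of the two statistics. Indicator functions then give equidistribution and monomials give the
  polynomial identity. The induction starts at n = 1, where D_1 is trivial and the sign change at 1
  already exists.\<close>

lemma signed_points_iff [simp]: "i \<in> signed_points n \<longleftrightarrow> i \<noteq> 0 \<and> \<bar>i\<bar> \<le> int n"
  by (auto simp: signed_points_def)

lemma finite_signed_points [simp]: "finite (signed_points n)"
  by (simp add: signed_points_def)

lemma B_group_permutes: "\<sigma> \<in> B_group n \<Longrightarrow> \<sigma> permutes signed_points n"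
  by (simp add: B_group_def)

text \<open>Outside the signed points both sides are fixed, so oddness holds at every integer and
  can be used without a membership condition.\<close>

lemma B_group_minus:
  assumes "\<sigma> \<in> B_group n"
  shows "\<sigma> (- i) = - \<sigma> i"
proof (cases "i \<in> signed_points n")
  case True
  then show ?thesis using assms unfolding B_group_def by blast
next
  case False
  then have "- i \<notin> signed_points n" by simp
  then show ?thesis using False permutes_not_in[OF B_group_permutes[OF assms]] by metis
qed

lemma B_groupI:
  assumes "\<sigma> permutes signed_points n" "\<And>i. \<sigma> (- i) = - \<sigma> i"
  shows "\<sigma> \<in> B_group n"
  using assms by (auto simp: B_group_def)

lemma B_group_fix: "\<sigma> \<in> B_group n \<Longrightarrow> \<bar>i\<bar> > int n \<Longrightarrow> \<sigma> i = i"
  using permutes_not_in[OF B_group_permutes, of \<sigma> n i] by auto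

lemma B_group_inj: "\<sigma> \<in> B_group n \<Longrightarrow> \<sigma> i = \<sigma> j \<longleftrightarrow> i = j"
  using permutes_inj[OF B_group_permutes] by (metis injD)

lemma B_group_range:
  assumes "\<sigma> \<in> B_group n" "i \<noteq> 0" "\<bar>i\<bar> \<le> int n"
  shows "\<sigma> i \<noteq> 0 \<and> \<bar>\<sigma> i\<bar> \<le> int n"
  using permutes_in_image[OF B_group_permutes[OF assms(1)], of i] assms by auto

lemma id_in_B_group [simp]: "id \<in> B_group n"
  by (rule B_groupI) (auto simp: permutes_id)

lemma B_group_comp: "\<sigma> \<in> B_group n \<Longrightarrow> \<tau> \<in> B_group n \<Longrightarrow> \<sigma> \<circ> \<tau> \<in> B_group n"
  by (rule B_groupI) (auto intro: permutes_compose B_group_permutes simp: B_group_minus)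

lemma B_group_inv:
  assumes "\<sigma> \<in> B_group n"
  shows "inv \<sigma> \<in> B_group n"
proof (rule B_groupI)
  show "inv \<sigma> permutes signed_points n"
    using permutes_inv[OF B_group_permutes[OF assms]] .
  fix i
  show "inv \<sigma> (- i) = - inv \<sigma> i"
    using B_group_minus[OF assms, of "inv \<sigma> i"] permutes_inverses[OF B_group_permutes[OF assms]]
    by metis
qed

lemma B_group_mono:
  assumes "m \<le> n" "\<sigma> \<in> B_group m"
  shows "\<sigma> \<in> B_group n"
proof (rule B_groupI)
  show "\<sigma> permutes signed_points n"
    by (rule permutes_subset[OF B_group_permutes[OF assms(2)]]) (use assms(1) in auto)
qed (simp add: B_group_minus[OF assms(2)])

lemma B_group_Suc: "\<sigma> \<in> B_group n \<Longrightarrow> \<sigma> \<in> B_group (Suc n)"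
  by (rule B_group_mono[of n]) auto

lemma B_group_shrink:
  assumes "\<sigma> \<in> B_group (Suc n)" "\<sigma> (int (Suc n)) = int (Suc n)"
  shows "\<sigma> \<in> B_group n"
proof (rule B_groupI)
  show "\<sigma> permutes signed_points n"
  proof (rule permutes_superset[OF B_group_permutes[OF assms(1)]])
    fix x assume "x \<in> signed_points (Suc n) - signed_points n"
    then have "x = int (Suc n) \<or> x = - int (Suc n)" by auto
    then show "\<sigma> x = x" using assms(2) B_group_minus[OF assms(1)] by metis
  qed
qed (simp add: B_group_minus[OF assms(1)])

lemma B_group_0: "\<sigma> \<in> B_group 0 \<Longrightarrow> \<sigma> = id"
  using B_group_permutes[of \<sigma> 0] by (simp add: signed_points_def)

lemma finite_B_group: "finite (B_group n)"
proof -
  have "B_group n \<subseteq> {\<sigma>. \<sigma> permutes signed_points n}" by (auto simp: B_group_def)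
  then show ?thesis using finite_permutations[OF finite_signed_points] finite_subset by blast
qed

section \<open>Reflections as signed permutations\<close>

lemma reflection_minus: "i \<noteq> 0 \<Longrightarrow> j \<noteq> 0 \<Longrightarrow> reflection i j (- x) = - reflection i j x"
  by (auto simp: reflection_def)

lemma reflection_idem: "i \<noteq> 0 \<Longrightarrow> j \<noteq> 0 \<Longrightarrow> reflection i j (reflection i j x) = x"
  by (auto simp: reflection_def)

lemma reflection_comp_self: "i \<noteq> 0 \<Longrightarrow> j \<noteq> 0 \<Longrightarrow> reflection i j \<circ> reflection i j = id"
  by (auto simp: reflection_idem)

lemma reflection_same [simp]: "reflection i i = id"
  by (auto simp: reflection_def)

lemma reflection_left [simp]: "reflection i j i = j"
  by (simp add: reflection_def)

lemma reflection_right [simp]: "reflection i j j = i"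
  by (simp add: reflection_def)

lemma reflection_in_B_group:
  assumes "i \<in> signed_points n" "j \<in> signed_points n"
  shows "reflection i j \<in> B_group n"
proof (rule B_groupI)
  have nz: "i \<noteq> 0" "j \<noteq> 0" using assms by auto
  have inS: "reflection i j x \<in> signed_points n" if "x \<in> signed_points n" for x
    using assms that by (auto simp: reflection_def)
  show "reflection i j permutes signed_points n"
  proof (rule bij_imp_permutes)
    show "bij_betw (reflection i j) (signed_points n) (signed_points n)"
      by (rule bij_betw_byWitness[of _ "reflection i j"])
        (use inS in \<open>auto simp: reflection_idem[OF nz]\<close>)
    show "reflection i j x = x" if "x \<notin> signed_points n" for x
      using assms that by (auto simp: reflection_def)
  qed
qed (use assms in \<open>simp add: reflection_minus\<close>)

text \<open>Conjugation relabels a reflection. This form, without inverses, is what moves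
  reflections past each other in the length argument.\<close>

lemma B_group_conj_reflection:
  assumes "\<sigma> \<in> B_group n"
  shows "\<sigma> \<circ> reflection i j = reflection (\<sigma> i) (\<sigma> j) \<circ> \<sigma>"
  by (rule ext)
    (auto simp: reflection_def B_group_inj[OF assms] B_group_minus[OF assms, symmetric])

section \<open>Signs and the cosets of the even subgroup\<close>

text \<open>The character of B_n with kernel D_n. A product of signs is multiplicative, which the
  parity of a number of negative entries is not visibly.\<close>

definition bsign :: "nat \<Rightarrow> (int \<Rightarrow> int) \<Rightarrow> int" where
  "bsign n \<sigma> = (\<Prod>i\<in>{1..int n}. sgn (\<sigma> i))"

lemma B_group_abs_bij:
  assumes "\<sigma> \<in> B_group n"
  shows "bij_betw (\<lambda>i. \<bar>\<sigma> i\<bar>) {1..int n} {1..int n}"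
proof -
  have inj: "inj_on (\<lambda>i. \<bar>\<sigma> i\<bar>) {1..int n}"
  proof (rule inj_onI)
    fix i j assume ij: "i \<in> {1..int n}" "j \<in> {1..int n}" "\<bar>\<sigma> i\<bar> = \<bar>\<sigma> j\<bar>"
    then have "\<sigma> i = \<sigma> j \<or> \<sigma> i = \<sigma> (- j)" by (auto simp: B_group_minus[OF assms] abs_eq_iff)
    then show "i = j" using ij by (auto simp: B_group_inj[OF assms])
  qed
  have sub: "(\<lambda>i. \<bar>\<sigma> i\<bar>) ` {1..int n} \<subseteq> {1..int n}"
  proof (rule image_subsetI)
    fix i assume "i \<in> {1..int n}"
    then show "\<bar>\<sigma> i\<bar> \<in> {1..int n}" using B_group_range[OF assms, of i] by auto
  qed
  show ?thesis
    using endo_inj_surj[OF _ sub inj] inj by (simp add: bij_betw_def)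
qed

text \<open>By oddness the sign of \<sigma> at \<tau>(i) splits off the sign of \<tau>(i), and the
  absolute values of \<tau> only permute the remaining factors.\<close>

lemma bsign_comp:
  assumes "\<sigma> \<in> B_group n" "\<tau> \<in> B_group n"
  shows "bsign n (\<sigma> \<circ> \<tau>) = bsign n \<sigma> * bsign n \<tau>"
proof -
  have "sgn (\<sigma> (\<tau> i)) = sgn (\<sigma> \<bar>\<tau> i\<bar>) * sgn (\<tau> i)" if "i \<in> {1..int n}" for i
    using B_group_range[OF assms(2), of i] B_group_minus[OF assms(1), of "\<tau> i"] that
    by (cases "\<tau> i > 0") (auto simp: abs_if)
  then have "bsign n (\<sigma> \<circ> \<tau>) = (\<Prod>i\<in>{1..int n}. sgn (\<sigma> \<bar>\<tau> i\<bar>)) * bsign n \<tau>"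
    unfolding bsign_def by (simp add: prod.distrib)
  also have "(\<Prod>i\<in>{1..int n}. sgn (\<sigma> \<bar>\<tau> i\<bar>)) = bsign n \<sigma>"
    unfolding bsign_def
    using prod.reindex_bij_betw[OF B_group_abs_bij[OF assms(2)], of "\<lambda>i. sgn (\<sigma> i)"] .
  finally show ?thesis .
qed

lemma bsign_eq_power:
  assumes "\<sigma> \<in> B_group n"
  shows "bsign n \<sigma> = (- 1) ^ card {i \<in> {1..int n}. \<sigma> i < 0}"
proof -
  have "bsign n \<sigma> = (\<Prod>i\<in>{1..int n}. if \<sigma> i < 0 then - 1 else 1)"
    unfolding bsign_def
  proof (rule prod.cong[OF refl])
    fix i assume "i \<in> {1..int n}"
    then show "sgn (\<sigma> i) = (if \<sigma> i < 0 then - 1 else 1)"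
      using B_group_range[OF assms, of i] by auto
  qed
  also have "\<dots> = (- 1) ^ card {i \<in> {1..int n}. \<sigma> i < 0}"
    by (simp flip: prod.inter_filter)
  finally show ?thesis .
qed

lemma D_group_iff: "\<sigma> \<in> D_group n \<longleftrightarrow> \<sigma> \<in> B_group n \<and> bsign n \<sigma> = 1"
  by (cases "\<sigma> \<in> B_group n") (simp_all add: D_group_def bsign_eq_power minus_one_power_iff)

lemma bsign_cases: "\<sigma> \<in> B_group n \<Longrightarrow> bsign n \<sigma> = 1 \<or> bsign n \<sigma> = - 1"
  by (auto simp: bsign_eq_power minus_one_power_iff)

lemma bsign_id [simp]: "bsign n id = 1"
  by (simp add: bsign_def)

lemma bsign_Suc:
  assumes "\<sigma> \<in> B_group n"
  shows "bsign (Suc n) \<sigma> = bsign n \<sigma>"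
proof -
  have "{1..int (Suc n)} = insert (int (Suc n)) {1..int n}" by auto
  then show ?thesis unfolding bsign_def by (simp add: B_group_fix[OF assms])
qed

lemma finite_D_group: "finite (D_group n)"
  using finite_B_group by (simp add: D_group_def)

lemma D_group_Suc: "\<sigma> \<in> D_group n \<Longrightarrow> \<sigma> \<in> D_group (Suc n)"
  by (simp add: D_group_iff B_group_Suc bsign_Suc)

lemma D_group_shrink:
  "\<sigma> \<in> D_group (Suc n) \<Longrightarrow> \<sigma> (int (Suc n)) = int (Suc n) \<Longrightarrow> \<sigma> \<in> D_group n"
  by (metis D_group_iff B_group_shrink bsign_Suc)

section \<open>The sign change at 1 and summation over D_(n+1)\<close>

abbreviation sign_one :: "int \<Rightarrow> int" where
  "sign_one \<equiv> reflection (- 1) 1"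

lemma sign_one_apply: "sign_one x = (if \<bar>x\<bar> = 1 then - x else x)"
  by (auto simp: reflection_def)

lemma sign_one_in_B_group: "n \<ge> 1 \<Longrightarrow> sign_one \<in> B_group n"
  by (rule reflection_in_B_group) auto

lemma sign_one_idem [simp]: "sign_one \<circ> sign_one = id"
  by (rule reflection_comp_self) auto

lemma bsign_sign_one:
  assumes "n \<ge> 1"
  shows "bsign n sign_one = - 1"
proof -
  have "{1..int n} = insert 1 {2..int n}" using assms by auto
  then show ?thesis unfolding bsign_def by (simp add: sign_one_apply)
qed

lemma D_group_1: "D_group 1 = {id}"
proof -
  have "\<sigma> = id" if "\<sigma> \<in> D_group 1" for \<sigma>
  proof -
    have B: "\<sigma> \<in> B_group (Suc 0)" and s: "bsign 1 \<sigma> = 1" using that by (auto simp: D_group_iff)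
    have "\<bar>\<sigma> 1\<bar> = 1" using B_group_range[OF B, of 1] by auto
    with s have "\<sigma> 1 = 1" by (auto simp: bsign_def abs_if split: if_splits)
    then show ?thesis using B_group_0 B_group_shrink[OF B] by simp
  qed
  then show ?thesis by (auto simp: D_group_iff)
qed

lemma B_group_preimage:
  assumes "\<tau> \<in> B_group n" "n \<ge> 1"
  shows "inv \<tau> (int n) \<in> signed_points n" "\<tau> (inv \<tau> (int n)) = int n"
  using B_group_range[OF B_group_inv[OF assms(1)], of "int n"] assms
    permutes_inverses[OF B_group_permutes[OF assms(1)]] by auto

text \<open>
  Every \<open>\<tau> \<in> D_group (Suc n)\<close> with \<open>\<tau> x = n + 1\<close> is \<open>\<sigma> \<circ> c x\<close> or \<open>sign_one \<circ> \<sigma> \<circ> c x\<close> for a unique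
  \<open>\<sigma> \<in> D_group n\<close>; the parity of \<open>c x\<close> decides which.
\<close>

lemma sum_D_group_Suc:
  fixes F :: "(int \<Rightarrow> int) \<Rightarrow> 'b::comm_monoid_add"
  assumes n: "n \<ge> 1"
    and c: "\<And>x. x \<in> signed_points (Suc n) \<Longrightarrow> c x \<in> B_group (Suc n) \<and> c x x = int (Suc n)"
    and F: "\<And>\<tau>. \<tau> \<in> B_group (Suc n) \<Longrightarrow> F (sign_one \<circ> \<tau>) = F \<tau>"
  shows "(\<Sum>\<tau>\<in>D_group (Suc n). F \<tau>) = (\<Sum>x\<in>signed_points (Suc n). \<Sum>\<sigma>\<in>D_group n. F (\<sigma> \<circ> c x))"
proof -
  let ?N = "int (Suc n)"
  let ?P = "\<lambda>x. {\<tau> \<in> D_group (Suc n). \<tau> x = ?N}"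
  \<comment> \<open>For n >= 1 the letters 1 and n+1 differ, so the switch keeps n+1 at its position
    and preserves the condition \<tau>(x) = n+1.\<close>
  have eB: "sign_one \<in> B_group (Suc n)" "sign_one ?N = ?N" "bsign (Suc n) sign_one = - 1"
    using n by (auto intro: sign_one_in_B_group simp: bsign_sign_one sign_one_apply)
  have un: "D_group (Suc n) = (\<Union>x\<in>signed_points (Suc n). ?P x)"
    using B_group_preimage[of _ "Suc n"] by (fastforce simp: D_group_iff)
  have "(\<Sum>\<tau>\<in>(\<Union>x\<in>signed_points (Suc n). ?P x). F \<tau>)
      = (\<Sum>x\<in>signed_points (Suc n). \<Sum>\<tau>\<in>?P x. F \<tau>)"
    by (rule sum.UNION_disjoint)
      (use finite_D_group in \<open>auto simp: D_group_iff finite_B_group dest: B_group_inj\<close>)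
  then have "(\<Sum>\<tau>\<in>D_group (Suc n). F \<tau>) = (\<Sum>x\<in>signed_points (Suc n). \<Sum>\<tau>\<in>?P x. F \<tau>)"
    unfolding un[symmetric] .
  also have "\<dots> = (\<Sum>x\<in>signed_points (Suc n). \<Sum>\<sigma>\<in>D_group n. F (\<sigma> \<circ> c x))"
  proof (rule sum.cong[OF refl])
    fix x assume x: "x \<in> signed_points (Suc n)"
    note cx = c[OF x, THEN conjunct1] c[OF x, THEN conjunct2]
    \<comment> \<open>\<open>e\<close> has the same sign as \<open>c x\<close>, so
      \<open>e \<circ> \<sigma> \<circ> c x\<close> is even exactly when \<sigma> is, and
      \<open>F\<close> does not see \<open>e\<close>.\<close>
    define e where "e = (if bsign (Suc n) (c x) = 1 then id else sign_one)"
    have e: "e \<in> B_group (Suc n)" "e ?N = ?N" "bsign (Suc n) e * bsign (Suc n) (c x) = 1"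
      "e \<circ> e = id"
      using eB bsign_cases[OF cx(1)] by (auto simp: e_def)
    have Fe: "F (e \<circ> \<tau>) = F \<tau>" if "\<tau> \<in> B_group (Suc n)" for \<tau>
      using F[OF that] by (auto simp: e_def)
    have cinv: "c x \<circ> inv (c x) = id" "inv (c x) \<circ> c x = id"
      using permutes_inv_o[OF B_group_permutes[OF cx(1)]] by auto
    have bc: "bsign (Suc n) (c x) * bsign (Suc n) (inv (c x)) = 1"
      using bsign_comp[OF cx(1) B_group_inv[OF cx(1)]] cinv by simp
    show "(\<Sum>\<tau>\<in>?P x. F \<tau>) = (\<Sum>\<sigma>\<in>D_group n. F (\<sigma> \<circ> c x))"
    proof (rule sum.reindex_bij_witness[of _ "\<lambda>\<sigma>. e \<circ> \<sigma> \<circ> c x" "\<lambda>\<tau>. e \<circ> \<tau> \<circ> inv (c x)"])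
      fix \<tau> assume t: "\<tau> \<in> ?P x"
      then have tB: "\<tau> \<in> B_group (Suc n)" "bsign (Suc n) \<tau> = 1" by (auto simp: D_group_iff)
      show "e \<circ> (e \<circ> \<tau> \<circ> inv (c x)) \<circ> c x = \<tau>"
        by (metis cinv(2) comp_assoc comp_id e(4) id_comp)
      have "e \<circ> \<tau> \<circ> inv (c x) \<in> D_group (Suc n)"
        using e(1,3) tB bc B_group_inv[OF cx(1)] cx(1)
        by (auto simp: D_group_iff B_group_comp bsign_comp zmult_eq_1_iff)
      moreover have "inv (c x) ?N = x"
        using cinv(2) cx(2) by (metis comp_apply id_apply)
      ultimately show "e \<circ> \<tau> \<circ> inv (c x) \<in> D_group n"
        using t e(2) D_group_shrink[of "e \<circ> \<tau> \<circ> inv (c x)" n] by simp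
      have "e \<circ> \<tau> \<circ> inv (c x) \<circ> c x = e \<circ> \<tau>"
        by (metis cinv(2) comp_assoc comp_id)
      then show "F (e \<circ> \<tau> \<circ> inv (c x) \<circ> c x) = F \<tau>"
        using Fe[OF tB(1)] by simp
    next
      fix \<sigma> assume s: "\<sigma> \<in> D_group n"
      then have sB: "\<sigma> \<in> B_group (Suc n)" "bsign (Suc n) \<sigma> = 1"
        using D_group_Suc by (auto simp: D_group_iff)
      show "e \<circ> (e \<circ> \<sigma> \<circ> c x) \<circ> inv (c x) = \<sigma>"
        by (metis cinv(1) comp_assoc comp_id e(4) id_comp)
      have "\<sigma> ?N = ?N" using s by (auto simp: D_group_iff B_group_fix)
      then show "e \<circ> \<sigma> \<circ> c x \<in> ?P x"
        using e(1-3) sB cx by (auto simp: D_group_iff B_group_comp bsign_comp)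
    qed
  qed
  finally show ?thesis .
qed

section \<open>Inversions under insertion of the largest letter\<close>

text \<open>
  Composing with this cycle on the right writes the letter \<open>n + 1\<close>, with the sign of \<open>x\<close>, at
  position \<open>\<bar>x\<bar>\<close> and shifts the later letters to the right.
\<close>

definition insertion_cycle :: "nat \<Rightarrow> int \<Rightarrow> int \<Rightarrow> int" where
  "insertion_cycle n x i =
     (if \<bar>i\<bar> = \<bar>x\<bar> then sgn i * sgn x * int (Suc n)
      else if \<bar>x\<bar> < \<bar>i\<bar> \<and> \<bar>i\<bar> \<le> int (Suc n) then i - sgn i else i)"

lemma insertion_cycle_in_B_group:
  assumes "x \<in> signed_points (Suc n)"
  shows "insertion_cycle n x \<in> B_group (Suc n)"
proof (rule B_groupI)
  let ?N = "int (Suc n)"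
  \<comment> \<open>A left inverse of the cycle: it sends n+1 and -(n+1) back to position x up to
    sign and undoes the shift. Injectivity is enough on a finite set.\<close>
  let ?g = "\<lambda>j. if \<bar>j\<bar> = ?N then sgn j * x
    else if \<bar>x\<bar> \<le> \<bar>j\<bar> \<and> \<bar>j\<bar> \<le> int n then j + sgn j else j"
  have x: "x \<noteq> 0" "\<bar>x\<bar> \<le> ?N" using assms by auto
  show "insertion_cycle n x permutes signed_points (Suc n)"
  proof (rule bij_imp_permutes)
    show "bij_betw (insertion_cycle n x) (signed_points (Suc n)) (signed_points (Suc n))"
    proof -
      have "?g (insertion_cycle n x i) = i" if "i \<in> signed_points (Suc n)" for i
        using x that by (cases "x > 0"; cases "i > 0") (auto simp: insertion_cycle_def)
      then have "inj_on (insertion_cycle n x) (signed_points (Suc n))"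
        by (rule inj_on_inverseI)
      moreover have "insertion_cycle n x ` signed_points (Suc n) \<subseteq> signed_points (Suc n)"
        using x by (auto simp: insertion_cycle_def sgn_if)
      ultimately show ?thesis
        using endo_inj_surj[OF finite_signed_points] by (simp add: bij_betw_def)
    qed
    show "insertion_cycle n x i = i" if "i \<notin> signed_points (Suc n)" for i
      using x that by (auto simp: insertion_cycle_def)
  qed
  show "insertion_cycle n x (- i) = - insertion_cycle n x i" for i
    by (auto simp: insertion_cycle_def sgn_if)
qed

lemma insertion_cycle_apply:
  assumes "x \<in> signed_points (Suc n)" "\<sigma> \<in> B_group n"
  shows "insertion_cycle n x x = int (Suc n)"
    and "(\<sigma> \<circ> insertion_cycle n x) \<bar>x\<bar> = sgn x * int (Suc n)"
    and "i \<in> {1..int n} \<Longrightarrow> (\<sigma> \<circ> insertion_cycle n x) (if i < \<bar>x\<bar> then i else i + 1) = \<sigma> i"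
  using assms(1) B_group_fix[OF assms(2), of "int (Suc n)"] B_group_fix[OF assms(2), of "- int (Suc n)"]
  by (auto simp: insertion_cycle_def sgn_if split: if_splits)

section \<open>Pairs of positions and single positions under an insertion\<close>

definition index_pairs :: "nat \<Rightarrow> (int \<times> int) set" where
  "index_pairs n = {(i, j). 1 \<le> i \<and> i < j \<and> j \<le> int n}"

lemma finite_index_pairs: "finite (index_pairs n)"
  by (rule finite_subset[of _ "{1..int n} \<times> {1..int n}"]) (auto simp: index_pairs_def)

text \<open>The map \<open>s\<close> skips position \<open>p\<close> and is strictly increasing, so
  it carries the old pairs onto the new pairs that avoid \<open>p\<close>. The other new pairs begin
  or end at \<open>p\<close>.\<close>

lemma sum_index_pairs_insert:
  fixes f :: "int \<Rightarrow> int \<Rightarrow> nat"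
  assumes p: "1 \<le> p" "p \<le> int (Suc n)"
    and \<tau>: "\<And>i. i \<in> {1..int n} \<Longrightarrow> \<tau> (if i < p then i else i + 1) = \<sigma> i"
  shows "(\<Sum>(i, j)\<in>index_pairs (Suc n). f (\<tau> i) (\<tau> j)) =
    (\<Sum>(i, j)\<in>index_pairs n. f (\<sigma> i) (\<sigma> j))
    + (\<Sum>j\<in>{p<..int (Suc n)}. f (\<tau> p) (\<tau> j)) + (\<Sum>i\<in>{1..<p}. f (\<tau> i) (\<tau> p))"
proof -
  define s where "s = (\<lambda>i. if i < p then i else i + 1)"
  have inj: "inj_on (map_prod s s) (index_pairs n)"
    by (auto simp: inj_on_def s_def split: if_splits)
  define M where "M = map_prod s s ` index_pairs n"
  have inM: "(i, j) \<in> M" if "1 \<le> i" "i < j" "j \<le> int (Suc n)" "i \<noteq> p" "j \<noteq> p" for i j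
    unfolding M_def using that p
    by (intro image_eqI[of _ _ "(if i < p then i else i - 1, if j < p then j else j - 1)"])
      (auto simp: s_def index_pairs_def)
  have M_sub: "M \<subseteq> index_pairs (Suc n)"
    by (auto simp: M_def s_def index_pairs_def)
  have eq: "index_pairs (Suc n) = M \<union> Pair p ` {p<..int (Suc n)} \<union> (\<lambda>i. (i, p)) ` {1..<p}"
  proof (rule subset_antisym; rule subrelI)
    fix i j assume "(i, j) \<in> index_pairs (Suc n)"
    then show "(i, j) \<in> M \<union> Pair p ` {p<..int (Suc n)} \<union> (\<lambda>i. (i, p)) ` {1..<p}"
      using inM[of i j] by (cases "i = p"; cases "j = p") (auto simp: index_pairs_def)
  next
    fix i j assume "(i, j) \<in> M \<union> Pair p ` {p<..int (Suc n)} \<union> (\<lambda>i. (i, p)) ` {1..<p}"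
    then show "(i, j) \<in> index_pairs (Suc n)"
      using M_sub p by (auto simp: index_pairs_def)
  qed
  have "(\<Sum>(i, j)\<in>M. f (\<tau> i) (\<tau> j))
      = (\<Sum>(i, j)\<in>index_pairs n. f (\<sigma> i) (\<sigma> j))"
    unfolding M_def sum.reindex[OF inj]
    by (rule sum.cong) (use \<tau> in \<open>auto simp: s_def index_pairs_def\<close>)
  moreover have "(\<Sum>(i, j)\<in>Pair p ` {p<..int (Suc n)}. f (\<tau> i) (\<tau> j))
      = (\<Sum>j\<in>{p<..int (Suc n)}. f (\<tau> p) (\<tau> j))"
    by (subst sum.reindex) (auto simp: inj_on_def)
  moreover have "(\<Sum>(i, j)\<in>(\<lambda>i. (i, p)) ` {1..<p}. f (\<tau> i) (\<tau> j)) = (\<Sum>i\<in>{1..<p}. f (\<tau> i) (\<tau> p))"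
    by (subst sum.reindex) (auto simp: inj_on_def)
  moreover have "M \<inter> Pair p ` {p<..int (Suc n)} = {}"
    "(M \<union> Pair p ` {p<..int (Suc n)}) \<inter> (\<lambda>i. (i, p)) ` {1..<p} = {}"
    by (auto simp: M_def s_def split: if_splits)
  moreover have "finite M" by (simp add: M_def finite_index_pairs)
  ultimately show ?thesis
    unfolding eq by (simp add: sum.union_disjoint)
qed

lemma card_insert_position:
  assumes p: "1 \<le> p" "p \<le> int (Suc n)"
  shows "card {i \<in> {1..int (Suc n)}. P i} =
    card {i \<in> {1..int n}. P (if i < p then i else i + 1)} + of_bool (P p)"
proof -
  define s where "s = (\<lambda>i. if i < p then i else i + 1)"
  have eq: "{i \<in> {1..int (Suc n)}. P i} =
    s ` {i \<in> {1..int n}. P (s i)} \<union> (if P p then {p} else {})"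
  proof -
    have "i \<in> s ` {i \<in> {1..int n}. P (s i)}"
      if "1 \<le> i" "i \<le> int (Suc n)" "i \<noteq> p" "P i" for i
      using that p by (intro image_eqI[of _ _ "if i < p then i else i - 1"]) (auto simp: s_def)
    then show ?thesis using p by (auto simp: s_def split: if_splits)
  qed
  have "card (s ` {i \<in> {1..int n}. P (s i)}) = card {i \<in> {1..int n}. P (s i)}"
    by (rule card_image) (auto simp: inj_on_def s_def split: if_splits)
  moreover have "p \<notin> s ` {i \<in> {1..int n}. P (s i)}" by (auto simp: s_def split: if_splits)
  ultimately have "card {i \<in> {1..int (Suc n)}. P i} = card {i \<in> {1..int n}. P (s i)} + of_bool (P p)"
    unfolding eq by (cases "P p") (simp_all add: card_insert_disjoint del: atLeastAtMost_iff)
  then show ?thesis unfolding s_def .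
qed

lemma inv_D_eq_sum:
  "inv_D n \<sigma> = (\<Sum>(i, j)\<in>index_pairs n. of_bool (\<sigma> i > \<sigma> j) + of_bool (- \<sigma> i > \<sigma> j))"
proof -
  have "card {(i, j). 1 \<le> i \<and> i < j \<and> j \<le> int n \<and> P i j} =
    (\<Sum>(i, j)\<in>index_pairs n. of_bool (P i j))" for P
  proof -
    have "{(i, j). 1 \<le> i \<and> i < j \<and> j \<le> int n \<and> P i j} = {x \<in> index_pairs n. case x of (i, j) \<Rightarrow> P i j}"
      by (auto simp: index_pairs_def)
    then show ?thesis
      by (simp add: finite_index_pairs sum.If_cases of_bool_def case_prod_beta Int_def)
  qed
  then show ?thesis by (simp add: inv_D_def case_prod_beta sum.distrib)
qed

text \<open>The summand of \<open>sor_D\<close> for the factor (i, j), and for j = n+1 also the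
  number of inversions created by inserting at i. At i = j it is 0, so the choice x = n+1 needs no
  separate treatment.\<close>

definition letter_weight :: "int \<Rightarrow> int \<Rightarrow> nat" where
  "letter_weight i j = nat (j - i - 2 * of_bool (i < 0))"

text \<open>Write a for the new letter. For each later letter b exactly one of a > b and -a > b
  holds, giving n+1-|x| in total. An earlier letter contributes 0 if a is positive and 2 if a is
  negative, giving 2(|x|-1) more for x < 0.\<close>

lemma inv_D_insertion:
  assumes x: "x \<in> signed_points (Suc n)" and \<sigma>: "\<sigma> \<in> B_group n"
  shows "inv_D (Suc n) (\<sigma> \<circ> insertion_cycle n x) = inv_D n \<sigma> + letter_weight x (int (Suc n))"
proof -
  let ?N = "int (Suc n)" and ?\<tau> = "\<sigma> \<circ> insertion_cycle n x"
  let ?f = "\<lambda>a b :: int. of_bool (a > b) + of_bool (- a > b) :: nat"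
  note app = insertion_cycle_apply[OF x \<sigma>]
  have p: "1 \<le> \<bar>x\<bar>" "\<bar>x\<bar> \<le> ?N" using x by auto
  have small: "\<bar>?\<tau> i\<bar> < ?N" if "1 \<le> i" "i \<le> ?N" "i \<noteq> \<bar>x\<bar>" for i
  proof -
    define k where "k = (if i < \<bar>x\<bar> then i else i - 1)"
    have "k \<in> {1..int n}" "(if k < \<bar>x\<bar> then k else k + 1) = i" using that p by (auto simp: k_def)
    then show ?thesis using app(3)[of k] B_group_range[OF \<sigma>, of k] by auto
  qed
  have "inv_D (Suc n) ?\<tau> = inv_D n \<sigma>
    + (\<Sum>j\<in>{\<bar>x\<bar><..?N}. ?f (?\<tau> \<bar>x\<bar>) (?\<tau> j)) + (\<Sum>i\<in>{1..<\<bar>x\<bar>}. ?f (?\<tau> i) (?\<tau> \<bar>x\<bar>))"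
    unfolding inv_D_eq_sum
    by (rule sum_index_pairs_insert[OF p, where f = ?f and \<tau> = ?\<tau> and \<sigma> = \<sigma>]) (rule app(3))
  also have "(\<Sum>j\<in>{\<bar>x\<bar><..?N}. ?f (?\<tau> \<bar>x\<bar>) (?\<tau> j)) = (\<Sum>j\<in>{\<bar>x\<bar><..?N}. 1)"
  proof (rule sum.cong[OF refl])
    fix j assume "j \<in> {\<bar>x\<bar><..?N}"
    then have "\<bar>?\<tau> j\<bar> < ?N" using p by (intro small) auto
    then show "?f (?\<tau> \<bar>x\<bar>) (?\<tau> j) = 1" unfolding app(2) using x by (auto simp: sgn_if)
  qed
  also have "(\<Sum>i\<in>{1..<\<bar>x\<bar>}. ?f (?\<tau> i) (?\<tau> \<bar>x\<bar>)) = (\<Sum>i\<in>{1..<\<bar>x\<bar>}. if x < 0 then 2 else 0)"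
  proof (rule sum.cong[OF refl])
    fix i assume "i \<in> {1..<\<bar>x\<bar>}"
    then have "\<bar>?\<tau> i\<bar> < ?N" using p by (intro small) auto
    then show "?f (?\<tau> i) (?\<tau> \<bar>x\<bar>) = (if x < 0 then 2 else 0)"
      unfolding app(2) using x by (auto simp: sgn_if)
  qed
  finally show ?thesis using p by (auto simp: letter_weight_def comp_def)
qed

text \<open>The new letter never lies below an old one in absolute value, so it changes nothing for
  the old positions. It is itself counted once: in the first set if positive and not last, in the
  second if negative, where n >= 1 makes it smaller than -1.\<close>

lemma nmin_D_insertion:
  assumes x: "x \<in> signed_points (Suc n)" and \<sigma>: "\<sigma> \<in> B_group n" and n: "n \<ge> 1"
  shows "nmin_D (Suc n) (\<sigma> \<circ> insertion_cycle n x) = nmin_D n \<sigma> + of_bool (x \<noteq> int (Suc n))"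
proof -
  let ?N = "int (Suc n)" and ?\<tau> = "\<sigma> \<circ> insertion_cycle n x"
  define s where "s = (\<lambda>i. if i < \<bar>x\<bar> then i else i + 1)"
  note app = insertion_cycle_apply[OF x \<sigma>]
  have p: "1 \<le> \<bar>x\<bar>" "\<bar>x\<bar> \<le> ?N" using x by auto
  have \<tau>s: "?\<tau> (s i) = \<sigma> i" if "i \<in> {1..int n}" for i using app(3)[OF that] by (simp add: s_def)
  have rng: "\<bar>\<sigma> i\<bar> < ?N" if "i \<in> {1..int n}" for i using B_group_range[OF \<sigma>, of i] that by auto
  have s_onto: "\<exists>k\<in>{1..int n}. j = s k" if "j \<in> {1..?N}" "j \<noteq> \<bar>x\<bar>" for j
    using that p by (intro bexI[of _ "if j < \<bar>x\<bar> then j else j - 1"]) (auto simp: s_def)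
  have s_mem: "s k \<in> {1..?N}" "s k \<noteq> \<bar>x\<bar>" if "k \<in> {1..int n}" for k
    using that by (auto simp: s_def)
  have s_less: "s i < s k \<longleftrightarrow> i < k" for i k by (auto simp: s_def)
  let ?P = "\<lambda>i. \<exists>j\<in>{1..?N}. j > i \<and> ?\<tau> i > \<bar>?\<tau> j\<bar>"
  have P_s: "?P (s i) \<longleftrightarrow> (\<exists>j\<in>{1..int n}. j > i \<and> \<sigma> i > \<bar>\<sigma> j\<bar>)" if i: "i \<in> {1..int n}" for i
  proof
    assume "?P (s i)"
    then obtain j where j: "j \<in> {1..?N}" "j > s i" "?\<tau> (s i) > \<bar>?\<tau> j\<bar>" by blast
    have "j \<noteq> \<bar>x\<bar>"
    proof
      assume "j = \<bar>x\<bar>"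
      then have "\<bar>?\<tau> j\<bar> = ?N" using app(2) x by (auto simp: abs_mult)
      then show False using j(3) rng[OF i] unfolding \<tau>s[OF i] by linarith
    qed
    then obtain k where "k \<in> {1..int n}" "j = s k" using s_onto[OF j(1)] by blast
    then show "\<exists>j\<in>{1..int n}. j > i \<and> \<sigma> i > \<bar>\<sigma> j\<bar>"
      using j s_less \<tau>s[OF i] \<tau>s[of k] by auto
  next
    assume "\<exists>j\<in>{1..int n}. j > i \<and> \<sigma> i > \<bar>\<sigma> j\<bar>"
    then obtain k where "k \<in> {1..int n}" "k > i" "\<sigma> i > \<bar>\<sigma> k\<bar>" by blast
    then show "?P (s i)"
      using s_less s_mem[of k] \<tau>s[OF i] \<tau>s[of k] by (intro bexI[of _ "s k"]) auto
  qed
  have P_p: "?P \<bar>x\<bar> \<longleftrightarrow> 0 < x \<and> x < ?N"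
  proof
    assume "?P \<bar>x\<bar>"
    then show "0 < x \<and> x < ?N" using app(2) x by (auto simp: sgn_if split: if_splits)
  next
    assume a: "0 < x \<and> x < ?N"
    then have "?N \<in> {1..?N}" "?N \<noteq> \<bar>x\<bar>" by auto
    then obtain k where k: "k \<in> {1..int n}" "?N = s k" using s_onto by blast
    then have "\<bar>?\<tau> ?N\<bar> < ?N" using rng \<tau>s by metis
    then show "?P \<bar>x\<bar>" using a app(2) by (intro bexI[of _ ?N]) auto
  qed
  have "nmin_D (Suc n) ?\<tau> = (card {i \<in> {1..int n}. ?P (s i)} + of_bool (?P \<bar>x\<bar>))
    + (card {i \<in> {1..int n}. ?\<tau> (s i) < - 1} + of_bool (?\<tau> \<bar>x\<bar> < - 1))"
    unfolding nmin_D_def s_def card_insert_position[OF p, of ?P]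
      card_insert_position[OF p, of "\<lambda>i. ?\<tau> i < - 1"] ..
  also have "{i \<in> {1..int n}. ?P (s i)} = {i \<in> {1..int n}. \<exists>j\<in>{1..int n}. j > i \<and> \<sigma> i > \<bar>\<sigma> j\<bar>}"
    using P_s by blast
  also have "{i \<in> {1..int n}. ?\<tau> (s i) < - 1} = {i \<in> {1..int n}. \<sigma> i < - 1}"
    using \<tau>s by auto
  also have "(?\<tau> \<bar>x\<bar> < - 1) \<longleftrightarrow> x < 0"
    unfolding app(2) using x n by (auto simp: sgn_if)
  finally show ?thesis unfolding P_p nmin_D_def using x by (auto simp: of_bool_def)
qed

text \<open>A pair a, b contributes 1 if |a| > |b|, and otherwise 0 or 2 according to the sign of b.
  So only the sign of a letter of absolute value at least 2 matters.\<close>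

lemma inv_D_sign_one:
  assumes "\<sigma> \<in> B_group n"
  shows "inv_D n (sign_one \<circ> \<sigma>) = inv_D n \<sigma>"
  unfolding inv_D_eq_sum
proof (rule sum.cong[OF refl], clarify)
  fix i j assume "(i, j) \<in> index_pairs n"
  then have ij: "1 \<le> i" "i < j" "j \<le> int n" by (auto simp: index_pairs_def)
  then have "\<sigma> i \<noteq> 0" "\<sigma> j \<noteq> 0" "\<bar>\<sigma> i\<bar> \<noteq> \<bar>\<sigma> j\<bar>"
    using B_group_range[OF assms, of i] B_group_range[OF assms, of j]
      B_group_inj[OF assms, of i j] B_group_inj[OF assms, of i "- j"] B_group_minus[OF assms, of j]
    by (auto simp: abs_eq_iff)
  then show "of_bool ((sign_one \<circ> \<sigma>) j < (sign_one \<circ> \<sigma>) i) + of_bool ((sign_one \<circ> \<sigma>) j < - (sign_one \<circ> \<sigma>) i)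
      = (of_bool (\<sigma> j < \<sigma> i) + of_bool (\<sigma> j < - \<sigma> i) :: nat)"
    by (auto simp: sign_one_apply of_bool_def)
qed

text \<open>The letter 1 exceeds no absolute value of a letter, and -1 is excluded by the strict
  bound in the second set.\<close>

lemma nmin_D_sign_one:
  assumes "\<sigma> \<in> B_group n"
  shows "nmin_D n (sign_one \<circ> \<sigma>) = nmin_D n \<sigma>"
proof -
  have nz: "\<sigma> i \<noteq> 0" if "i \<in> {1..int n}" for i using B_group_range[OF assms, of i] that by auto
  have a: "\<bar>(sign_one \<circ> \<sigma>) j\<bar> = \<bar>\<sigma> j\<bar>" for j by (auto simp: sign_one_apply)
  have b: "(sign_one \<circ> \<sigma>) i > \<bar>\<sigma> j\<bar> \<longleftrightarrow> \<sigma> i > \<bar>\<sigma> j\<bar>" if "j \<in> {1..int n}" for i j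
    using nz[OF that] by (auto simp: sign_one_apply)
  have c: "(sign_one \<circ> \<sigma>) i < - 1 \<longleftrightarrow> \<sigma> i < - 1" for i by (auto simp: sign_one_apply)
  show ?thesis unfolding nmin_D_def a c using b by (auto intro!: arg_cong[where f = card])
qed

lemma inv_D_id: "inv_D n id = 0"
  unfolding inv_D_eq_sum by (rule sum.neutral) (auto simp: index_pairs_def)

lemma nmin_D_id: "nmin_D n id = 0"
  by (auto simp: nmin_D_def card_eq_0_iff)

section \<open>The sorting code\<close>

text \<open>Selection sort: the reflection moves the largest letter into place and, being an
  involution, is the last factor of \<sigma>. If the letter is already in place,
  \<open>reflection x x\<close> is the identity and no label is recorded.\<close>

primrec sort_code :: "nat \<Rightarrow> (int \<Rightarrow> int) \<Rightarrow> (int \<times> int) list" where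
  "sort_code 0 \<sigma> = []"
| "sort_code (Suc n) \<sigma> =
    (let x = inv \<sigma> (int (Suc n))
     in sort_code n (\<sigma> \<circ> reflection x (int (Suc n))) @
       (if x = int (Suc n) then [] else [(x, int (Suc n))]))"

lemma sort_code_comp_reflection:
  assumes "\<sigma> \<in> B_group n" "x \<in> signed_points (Suc n)"
  shows "sort_code (Suc n) (\<sigma> \<circ> reflection x (int (Suc n))) =
    sort_code n \<sigma> @ (if x = int (Suc n) then [] else [(x, int (Suc n))])"
proof -
  let ?r = "reflection x (int (Suc n))"
  have B: "\<sigma> \<circ> ?r \<in> B_group (Suc n)"
    using assms by (intro B_group_comp B_group_Suc reflection_in_B_group) auto
  have "(\<sigma> \<circ> ?r) x = int (Suc n)" using B_group_fix[OF assms(1)] by simp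
  then have "inv (\<sigma> \<circ> ?r) (int (Suc n)) = x"
    using permutes_inv_eq[OF B_group_permutes[OF B]] by blast
  moreover have "\<sigma> \<circ> ?r \<circ> ?r = \<sigma>"
    using assms(2) by (simp add: comp_assoc reflection_comp_self)
  ultimately show ?thesis by (simp add: Let_def del: of_nat_Suc)
qed

text \<open>One step of selection sort, turned into a case rule for inductions over B_n.\<close>

lemma B_group_Suc_cases:
  assumes "\<tau> \<in> B_group (Suc n)"
  obtains \<sigma> x where "\<sigma> \<in> B_group n" "x \<in> signed_points (Suc n)"
    "\<tau> = \<sigma> \<circ> reflection x (int (Suc n))"
proof -
  let ?N = "int (Suc n)"
  let ?x = "inv \<tau> ?N"
  have x: "?x \<in> signed_points (Suc n)" "\<tau> ?x = ?N" using B_group_preimage[OF assms] by auto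
  have "\<tau> \<circ> reflection ?x ?N \<in> B_group (Suc n)"
    using x assms by (intro B_group_comp reflection_in_B_group) auto
  moreover have "(\<tau> \<circ> reflection ?x ?N) ?N = ?N" using x by simp
  ultimately have "\<tau> \<circ> reflection ?x ?N \<in> B_group n" by (rule B_group_shrink)
  moreover have "\<tau> = \<tau> \<circ> reflection ?x ?N \<circ> reflection ?x ?N"
    using x(1) by (simp add: comp_assoc reflection_comp_self)
  ultimately show ?thesis using that x(1) by blast
qed

section \<open>Existence and uniqueness of the sorting factorization\<close>

lemma prod_comp_Nil [simp]: "prod_comp [] = id"
  by (simp add: prod_comp_def)

lemma prod_comp_Cons [simp]: "prod_comp (f # fs) = f \<circ> prod_comp fs"
  by (simp add: prod_comp_def)

lemma prod_comp_append: "prod_comp (fs @ gs) = prod_comp fs \<circ> prod_comp gs"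
  by (induction fs) (simp_all add: comp_assoc)

lemma prod_comp_in_B_group: "set fs \<subseteq> B_group n \<Longrightarrow> prod_comp fs \<in> B_group n"
  by (induction fs) (simp_all add: B_group_comp)

lemma TB_labels_iff: "(i, j) \<in> TB_labels n \<longleftrightarrow> i \<noteq> 0 \<and> - j \<le> i \<and> i < j \<and> j \<le> int n"
  by (auto simp: TB_labels_def)

lemma TB_labels_Suc: "TB_labels n \<subseteq> TB_labels (Suc n)"
  by (auto simp: TB_labels_def)

lemma reflection_TB_in_B_group: "(i, j) \<in> TB_labels n \<Longrightarrow> reflection i j \<in> B_group n"
  by (rule reflection_in_B_group) (auto simp: TB_labels_iff)

lemma prod_reflections_in_B_group:
  "set ps \<subseteq> TB_labels n \<Longrightarrow> prod_comp (map (\<lambda>(i, j). reflection i j) ps) \<in> B_group n"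
  by (rule prod_comp_in_B_group) (auto intro: reflection_TB_in_B_group)

text \<open>The second labels increase strictly, so n+1 can occur only in the last one. The value x
  = n+1 encodes that it does not occur.\<close>

lemma sorting_factorization_Suc:
  "sorting_factorization (Suc n) \<tau> ps \<longleftrightarrow>
    (\<exists>\<sigma> x qs. sorting_factorization n \<sigma> qs \<and> x \<in> signed_points (Suc n) \<and>
      \<tau> = \<sigma> \<circ> reflection x (int (Suc n)) \<and>
      ps = qs @ (if x = int (Suc n) then [] else [(x, int (Suc n))]))"
  (is "?L \<longleftrightarrow> ?R")
proof
  let ?N = "int (Suc n)" and ?f = "\<lambda>(i, j). reflection i j"
  assume L: ?L
  then have T: "set ps \<subseteq> TB_labels (Suc n)" and S: "sorted_wrt (<) (map snd ps)"
    and P: "prod_comp (map ?f ps) = \<tau>" by (auto simp: sorting_factorization_def)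
  show ?R
  proof (cases "\<exists>qs x. ps = qs @ [(x, ?N)]")
    case True
    then obtain qs x where ps: "ps = qs @ [(x, ?N)]" by blast
    have "set qs \<subseteq> TB_labels n"
    proof (rule subrelI)
      fix i j assume "(i, j) \<in> set qs"
      then show "(i, j) \<in> TB_labels n"
        using S T unfolding ps by (force simp: sorted_wrt_append TB_labels_iff)
    qed
    then have "sorting_factorization n (prod_comp (map ?f qs)) qs"
      using S unfolding ps by (simp add: sorting_factorization_def sorted_wrt_append)
    moreover have "\<tau> = prod_comp (map ?f qs) \<circ> reflection x ?N"
      using P unfolding ps by (simp add: prod_comp_append)
    moreover have "(x, ?N) \<in> TB_labels (Suc n)" using T unfolding ps by simp
    then have "x \<in> signed_points (Suc n)" "x \<noteq> ?N" by (auto simp: TB_labels_iff)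
    ultimately show ?thesis unfolding ps
      by (intro exI[of _ "prod_comp (map ?f qs)"] exI[of _ x] exI[of _ qs]) simp
  next
    case False
    have "set ps \<subseteq> TB_labels n"
    proof (cases ps rule: rev_cases)
      case (snoc qs y)
      obtain a b where y: "y = (a, b)" by fastforce
      have b: "b < ?N" using False T snoc y by (force simp: TB_labels_iff)
      show ?thesis
      proof (rule subrelI)
        fix i j assume ij: "(i, j) \<in> set ps"
        then have "j \<le> b" using S unfolding snoc y by (force simp: sorted_wrt_append)
        then show "(i, j) \<in> TB_labels n" using ij b T by (force simp: TB_labels_iff)
      qed
    qed simp
    then have "sorting_factorization n \<tau> ps"
      using S P by (simp add: sorting_factorization_def)
    then show ?thesis
      by (intro exI[of _ \<tau>] exI[of _ ?N] exI[of _ ps]) simp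
  qed
next
  let ?N = "int (Suc n)" and ?f = "\<lambda>(i, j). reflection i j"
  assume ?R
  then obtain \<sigma> x qs where T: "set qs \<subseteq> TB_labels n" and S: "sorted_wrt (<) (map snd qs)"
    and P: "prod_comp (map ?f qs) = \<sigma>" and x: "x \<in> signed_points (Suc n)"
    and \<tau>: "\<tau> = \<sigma> \<circ> reflection x ?N" and ps: "ps = qs @ (if x = ?N then [] else [(x, ?N)])"
    unfolding sorting_factorization_def by blast
  have "set ps \<subseteq> TB_labels (Suc n)"
    using subset_trans[OF T TB_labels_Suc] x unfolding ps by (auto simp: TB_labels_iff)
  moreover have "sorted_wrt (<) (map snd ps)"
    using T S unfolding ps by (force simp: sorted_wrt_append TB_labels_iff)
  moreover have "prod_comp (map ?f ps) = \<tau>"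
    using P unfolding ps \<tau> by (simp add: prod_comp_append)
  ultimately show ?L by (simp add: sorting_factorization_def)
qed

text \<open>Existence and uniqueness in a single equivalence, which is what evaluates the
  description in \<open>sor_D\<close>.\<close>

lemma sorting_factorization_iff:
  "\<sigma> \<in> B_group n \<Longrightarrow> sorting_factorization n \<sigma> ps \<longleftrightarrow> ps = sort_code n \<sigma>"
proof (induction n arbitrary: \<sigma> ps)
  case 0
  have "TB_labels 0 = {}" by (auto simp: TB_labels_def)
  then show ?case using B_group_0[OF 0] by (auto simp: sorting_factorization_def)
next
  case (Suc n)
  let ?N = "int (Suc n)"
  obtain \<rho> x where \<rho>: "\<rho> \<in> B_group n" "x \<in> signed_points (Suc n)" "\<sigma> = \<rho> \<circ> reflection x ?N"
    using B_group_Suc_cases[OF Suc.prems] .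
  \<comment> \<open>The remaining product lies in B_n and fixes n+1, so the last label has to be the
    preimage of n+1 under \<sigma>.\<close>
  have unique: "\<rho>' = \<rho> \<and> y = x"
    if "sorting_factorization n \<rho>' qs" "y \<in> signed_points (Suc n)" "\<sigma> = \<rho>' \<circ> reflection y ?N"
    for \<rho>' y qs
  proof -
    have \<rho>': "\<rho>' \<in> B_group n"
      using that(1) prod_reflections_in_B_group by (auto simp: sorting_factorization_def)
    have "\<sigma> y = ?N" using that(3) B_group_fix[OF \<rho>', of ?N] by simp
    moreover have "\<sigma> x = ?N" using \<rho>(3) B_group_fix[OF \<rho>(1), of ?N] by simp
    ultimately have "y = x" using B_group_inj[OF Suc.prems] by metis
    moreover from this have "\<rho>' = \<rho> \<circ> reflection x ?N \<circ> reflection x ?N"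
      unfolding \<rho>(3)[symmetric] that(3) using \<rho>(2) by (simp add: comp_assoc reflection_comp_self)
    then have "\<rho>' = \<rho>" using \<rho>(2) by (simp add: comp_assoc reflection_comp_self)
    ultimately show ?thesis by simp
  qed
  have "sorting_factorization (Suc n) \<sigma> ps \<longleftrightarrow>
      (\<exists>qs. sorting_factorization n \<rho> qs \<and> ps = qs @ (if x = ?N then [] else [(x, ?N)]))"
    unfolding sorting_factorization_Suc using unique \<rho>(2,3) by blast
  also have "\<dots> \<longleftrightarrow> ps = sort_code n \<rho> @ (if x = ?N then [] else [(x, ?N)])"
    unfolding Suc.IH[OF \<rho>(1)] by blast
  finally show ?case
    unfolding \<rho>(3) sort_code_comp_reflection[OF \<rho>(1,2)] .
qed

section \<open>Weighted sums over the sorting code\<close>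

definition code_sum :: "(int \<Rightarrow> int \<Rightarrow> nat) \<Rightarrow> nat \<Rightarrow> (int \<Rightarrow> int) \<Rightarrow> nat" where
  "code_sum w n \<sigma> = (\<Sum>(i, j) \<leftarrow> sort_code n \<sigma>. w i j)"

lemma code_sum_comp_reflection:
  assumes "\<sigma> \<in> B_group n" "x \<in> signed_points (Suc n)"
  shows "code_sum w (Suc n) (\<sigma> \<circ> reflection x (int (Suc n))) =
    code_sum w n \<sigma> + (if x = int (Suc n) then 0 else w x (int (Suc n)))"
  unfolding code_sum_def sort_code_comp_reflection[OF assms] by simp

lemma code_sum_Suc:
  assumes "\<sigma> \<in> B_group n"
  shows "code_sum w (Suc n) \<sigma> = code_sum w n \<sigma>"
  using code_sum_comp_reflection[OF assms, of "int (Suc n)" w] by simp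

lemma code_sum_id [simp]: "code_sum w n id = 0"
proof (induction n)
  case 0
  show ?case by (simp add: code_sum_def)
qed (simp only: code_sum_Suc[OF id_in_B_group])

text \<open>Left multiplication leaves the last factor alone, so the claim descends to B_1. Its only
  possible label is (-1, 1), of weight 0.\<close>

lemma code_sum_sign_one:
  assumes w: "w (- 1) 1 = 0"
  shows "n \<ge> 1 \<Longrightarrow> \<sigma> \<in> B_group n \<Longrightarrow> code_sum w n (sign_one \<circ> \<sigma>) = code_sum w n \<sigma>"
proof (induction n arbitrary: \<sigma> rule: dec_induct)
  case base
  have zero: "code_sum w (Suc 0) \<tau> = 0" if \<tau>: "\<tau> \<in> B_group (Suc 0)" for \<tau>
  proof -
    obtain \<rho> x where \<rho>: "\<rho> \<in> B_group 0" "x \<in> signed_points (Suc 0)" "\<tau> = \<rho> \<circ> reflection x (int (Suc 0))"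
      using B_group_Suc_cases[OF \<tau>] .
    then have "x = 1 \<or> x = - 1" by auto
    then show ?thesis
      using code_sum_comp_reflection[OF \<rho>(1,2), of w] w B_group_0[OF \<rho>(1)] \<rho>(3) by auto
  qed
  have \<sigma>: "\<sigma> \<in> B_group (Suc 0)" using base by simp
  then have "sign_one \<circ> \<sigma> \<in> B_group (Suc 0)"
    by (intro B_group_comp sign_one_in_B_group) auto
  then show ?case by (simp only: One_nat_def zero \<sigma>)
next
  case (step n)
  obtain \<rho> x where \<rho>: "\<rho> \<in> B_group n" "x \<in> signed_points (Suc n)" "\<sigma> = \<rho> \<circ> reflection x (int (Suc n))"
    using B_group_Suc_cases[OF step.prems] .
  have "sign_one \<circ> \<rho> \<in> B_group n"
    using step.hyps \<rho>(1) by (intro B_group_comp sign_one_in_B_group)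
  then show ?case
    by (simp only: \<rho>(3) comp_assoc[symmetric] code_sum_comp_reflection \<rho>(1,2) step.IH[OF \<rho>(1)])
qed

lemma sor_D_eq_code_sum:
  assumes "\<sigma> \<in> B_group n"
  shows "sor_D n \<sigma> = code_sum letter_weight n \<sigma>"
proof -
  have the: "(THE ps. sorting_factorization n \<sigma> ps) = sort_code n \<sigma>"
    using sorting_factorization_iff[OF assms] by simp
  have "sorting_factorization n \<sigma> (sort_code n \<sigma>)"
    using sorting_factorization_iff[OF assms] by simp
  then have sub: "set (sort_code n \<sigma>) \<subseteq> TB_labels n" by (simp add: sorting_factorization_def)
  \<comment> \<open>No summand on a label is negative, the value at (-1, 1) being 0, so truncating
    each summand agrees with truncating the sum.\<close>
  have "(\<Sum>(i, j) \<leftarrow> ps. j - i - 2 * of_bool (i < 0)) = int (\<Sum>(i, j) \<leftarrow> ps. letter_weight i j)"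
    if "set ps \<subseteq> TB_labels n" for ps
    using that by (induction ps) (auto simp: letter_weight_def TB_labels_iff)
  from this[OF sub] show ?thesis unfolding sor_D_def the code_sum_def by simp
qed

section \<open>Reflection length\<close>

text \<open>
  The sign change at 1 has weight 0. Up to this free factor the reflections of types B and D
  coincide, so the weighted length of a sorting code is the type D reflection length: an arbitrary
  factorization can be sorted by exchange moves that never increase the weight.
\<close>

definition reflection_weight :: "int \<Rightarrow> int \<Rightarrow> nat" where
  "reflection_weight i j = of_bool ((i, j) \<noteq> (- 1, 1))"

lemma reflection_commute: "reflection i j = reflection j i"
  by (auto simp: reflection_def)

lemma reflection_uminus: "i \<noteq> 0 \<Longrightarrow> j \<noteq> 0 \<Longrightarrow> reflection (- i) (- j) = reflection i j"
  by (auto simp: reflection_def)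

lemma reflection_label_exists:
  assumes "a \<in> signed_points n" "b \<in> signed_points n" "a \<noteq> b"
  obtains i j where "(i, j) \<in> TB_labels n" "reflection a b = reflection i j"
proof -
  have *: "\<exists>i j. (i, j) \<in> TB_labels n \<and> reflection a b = reflection i j"
    if "a \<in> signed_points n" "b \<in> signed_points n" "a \<noteq> b" "\<bar>a\<bar> \<le> \<bar>b\<bar>" for a b
  proof (cases "b > 0")
    case True
    then show ?thesis using that by (intro exI[of _ a] exI[of _ b]) (auto simp: TB_labels_iff)
  next
    case False
    then show ?thesis using that reflection_uminus[of a b]
      by (intro exI[of _ "- a"] exI[of _ "- b"]) (auto simp: TB_labels_iff)
  qed
  show ?thesis
    using *[of a b] *[of b a] assms that reflection_commute[of a b] by (metis linear)
qed

text \<open>Two relations in the copy of B_2 on a and b. They serve the cases in which plain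
  conjugation would leave b in the left factor.\<close>

lemma reflection_exchange_sign:
  assumes "a \<noteq> 0" "b \<noteq> 0" "a \<noteq> b" "a \<noteq> - b"
  shows "reflection (- b) b \<circ> reflection a b = reflection a (- a) \<circ> reflection (- a) b"
    and "reflection a b \<circ> reflection (- a) b = reflection a (- a) \<circ> reflection (- b) b"
  using assms by (auto simp: reflection_def fun_eq_iff)

text \<open>Two factors at n+1 are traded for one factor in B_n and one at n+1, so the number of
  factors does not grow and the new left factor is open to induction.\<close>

lemma reflection_exchange:
  assumes "x \<in> signed_points (Suc n)" "a \<in> signed_points (Suc n)"
    and "x \<noteq> int (Suc n)" "a \<noteq> int (Suc n)" "x \<noteq> a"
  obtains i j y where "(i, j) \<in> TB_labels n" "y \<in> signed_points (Suc n)" "y \<noteq> int (Suc n)"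
    "reflection x (int (Suc n)) \<circ> reflection a (int (Suc n)) =
      reflection i j \<circ> reflection y (int (Suc n))"
proof -
  let ?N = "int (Suc n)"
  \<comment> \<open>The left factor obtained here avoids n+1 up to sign unless x = -(n+1) or k = -x.
    Exactly these two cases use the B_2 relations.\<close>
  have conj: "reflection x ?N \<circ> reflection k ?N = reflection (reflection x ?N k) x \<circ> reflection x ?N" for k
    using B_group_conj_reflection[OF reflection_in_B_group[OF assms(1)], of ?N k ?N] by simp
  have "\<exists>b c y. b \<in> signed_points n \<and> c \<in> signed_points n \<and> b \<noteq> c \<and>
    y \<in> signed_points (Suc n) \<and> y \<noteq> ?N \<and>
    reflection x ?N \<circ> reflection a ?N = reflection b c \<circ> reflection y ?N"
  proof -
    consider "x = - ?N" | "a = - ?N" "x \<noteq> - ?N" | "a = - x" "x \<noteq> - ?N" "a \<noteq> - ?N"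
      | "\<bar>a\<bar> \<noteq> \<bar>x\<bar>" "x \<noteq> - ?N" "a \<noteq> - ?N" using assms by (auto simp: abs_eq_iff)
    then show ?thesis
    proof cases
      case 1
      then have "a \<noteq> 0" "a \<noteq> - ?N" using assms by auto
      then show ?thesis using assms 1 reflection_exchange_sign(1)[of a ?N]
        by (intro exI[of _ a] exI[of _ "- a"] exI[of _ "- a"]) auto
    next
      case 2
      have "reflection x ?N \<circ> reflection a ?N = reflection (- x) x \<circ> reflection x ?N"
        using conj[of a] 2 assms by (simp add: reflection_def)
      then show ?thesis using assms 2
        by (intro exI[of _ "- x"] exI[of _ x] exI[of _ x]) auto
    next
      case 3
      then have "x \<noteq> 0" using assms by auto
      then show ?thesis using assms 3 reflection_exchange_sign(2)[of x ?N]
        by (intro exI[of _ x] exI[of _ "- x"] exI[of _ "- ?N"]) auto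
    next
      case 4
      then have "reflection x ?N a = a" using assms by (auto simp: reflection_def)
      then have "reflection x ?N \<circ> reflection a ?N = reflection a x \<circ> reflection x ?N"
        using conj[of a] by simp
      then show ?thesis using assms 4
        by (intro exI[of _ a] exI[of _ x] exI[of _ x]) auto
    qed
  qed
  then show ?thesis using that by (metis reflection_label_exists)
qed

text \<open>A reflection in B_n is moved past the last factor and left to the induction. A
  reflection at n+1 is appended, cancels the last factor, or is exchanged with it, which again
  leaves a reflection in B_n to the induction.\<close>

lemma code_sum_mult_reflection:
  "\<tau> \<in> B_group n \<Longrightarrow> (a, b) \<in> TB_labels n \<Longrightarrow>
    code_sum reflection_weight n (\<tau> \<circ> reflection a b)
      \<le> code_sum reflection_weight n \<tau> + reflection_weight a b"
proof (induction n arbitrary: \<tau> a b)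
  case 0
  then show ?case by (simp add: TB_labels_iff)
next
  case (Suc n)
  let ?N = "int (Suc n)" and ?w = reflection_weight
  let ?l = "code_sum reflection_weight"
  obtain \<sigma> x where \<sigma>: "\<sigma> \<in> B_group n" and x: "x \<in> signed_points (Suc n)"
    and \<tau>: "\<tau> = \<sigma> \<circ> reflection x ?N"
    using B_group_Suc_cases[OF Suc.prems(1)] .
  note l\<tau> = code_sum_comp_reflection[OF \<sigma> x, of ?w, folded \<tau>]
  show ?case
  proof (cases "b = ?N")
    case False
    let ?r = "reflection a b"
    have ab: "(a, b) \<in> TB_labels n" using False Suc.prems(2) by (auto simp: TB_labels_iff)
    note rB = reflection_TB_in_B_group[OF ab]
    have n: "n \<ge> 1" using ab by (auto simp: TB_labels_iff)
    have rN: "?r ?N = ?N" using B_group_fix[OF rB] by simp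
    have rx: "?r x \<in> signed_points (Suc n)"
      using B_group_range[OF B_group_Suc[OF rB], of x] x by simp
    have rr: "?r (?r x) = x" using ab by (intro reflection_idem) (auto simp: TB_labels_iff)
    have rx_N: "?r x = ?N \<longleftrightarrow> x = ?N" using rN B_group_inj[OF rB, of x ?N] by simp
    \<comment> \<open>Since \<open>?r\<close> fixes n+1, conjugation only relabels the last factor.
      Its weight stays 1, because n >= 1 keeps every label at n+1 different from (-1, 1).\<close>
    have "?r \<circ> reflection (?r x) ?N = reflection x ?N \<circ> ?r"
      using B_group_conj_reflection[OF rB, of "?r x" ?N] unfolding rr rN .
    then have "\<tau> \<circ> ?r = (\<sigma> \<circ> ?r) \<circ> reflection (?r x) ?N"
      unfolding \<tau> by (simp add: comp_assoc)
    then have "?l (Suc n) (\<tau> \<circ> ?r) = ?l n (\<sigma> \<circ> ?r) + (if x = ?N then 0 else ?w (?r x) ?N)"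
      using code_sum_comp_reflection[OF B_group_comp[OF \<sigma> rB] rx, of ?w] rx_N by simp
    moreover have "?w y ?N = 1" for y using n by (simp add: reflection_weight_def)
    ultimately show ?thesis using Suc.IH[OF \<sigma> ab] l\<tau> by (simp add: comp_def)
  next
    case True
    have a: "a \<in> signed_points (Suc n)" "a \<noteq> ?N" using Suc.prems(2) True by (auto simp: TB_labels_iff)
    consider "x = ?N" | "x = a" | "x \<noteq> ?N" "x \<noteq> a" by blast
    then show ?thesis
    proof cases
      case 1
      then have "\<tau> = \<sigma>" using \<tau> by simp
      then show ?thesis
        using code_sum_comp_reflection[OF \<sigma> a(1), of ?w] a(2) True code_sum_Suc[OF \<sigma>]
        by (simp add: comp_def)
    next
      case 2
      then have "\<tau> \<circ> reflection a b = \<sigma>"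
        using \<tau> True a(1) by (simp add: comp_assoc reflection_comp_self)
      then show ?thesis using code_sum_Suc[OF \<sigma>] l\<tau> by simp
    next
      case 3
      then obtain i j y where ij: "(i, j) \<in> TB_labels n" and y: "y \<in> signed_points (Suc n)" "y \<noteq> ?N"
        and eq: "reflection x ?N \<circ> reflection a ?N = reflection i j \<circ> reflection y ?N"
        using reflection_exchange[OF x a(1)] a(2) by metis
      have "n \<ge> 1" using ij by (auto simp: TB_labels_iff)
      then have w: "?w z ?N = 1" for z by (simp add: reflection_weight_def)
      have "\<tau> \<circ> reflection a b = (\<sigma> \<circ> reflection i j) \<circ> reflection y ?N"
        unfolding \<tau> True using eq by (simp add: comp_assoc)
      then have "?l (Suc n) (\<tau> \<circ> reflection a b) = ?l n (\<sigma> \<circ> reflection i j) + 1"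
        using code_sum_comp_reflection[OF B_group_comp[OF \<sigma> reflection_TB_in_B_group[OF ij]] y(1), of ?w]
          y(2) w by simp
      also have "\<dots> \<le> ?l n \<sigma> + ?w i j + 1" using Suc.IH[OF \<sigma> ij] by (rule add_right_mono)
      also have "\<dots> \<le> ?l (Suc n) \<tau> + ?w a b"
        using l\<tau> 3 w True by (simp add: reflection_weight_def)
      finally show ?thesis .
    qed
  qed
qed

lemma reflection_weight_le: "reflection_weight i j \<le> 1"
  by (simp add: reflection_weight_def)

section \<open>Lower bound for the length\<close>

lemma T_D_cases:
  assumes "t \<in> T_D n"
  obtains i j where "(i, j) \<in> TB_labels n" "t = reflection i j"
  | i where "(- i, i) \<in> TB_labels n" "(- 1, 1) \<in> TB_labels n" "t = reflection (- i) i \<circ> sign_one"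
  using assms unfolding T_D_def
proof (elim UnE CollectE exE conjE)
  fix i j assume "t = reflection i j" "1 \<le> \<bar>i\<bar>" "\<bar>i\<bar> < j" "j \<le> int n"
  then show thesis by (intro that(1)[of i j]) (auto simp: TB_labels_iff)
next
  fix i assume "t = reflection (- i) i \<circ> sign_one" "1 < i" "i \<le> int n"
  then show thesis by (intro that(2)[of i]) (auto simp: TB_labels_iff)
qed

lemma T_D_in_B_group: "t \<in> T_D n \<Longrightarrow> t \<in> B_group n"
  by (erule T_D_cases) (simp_all add: B_group_comp reflection_TB_in_B_group)

lemma T_D_Suc: "T_D n \<subseteq> T_D (Suc n)"
  unfolding T_D_def by fastforce

text \<open>A generator with two type B factors also costs at most 1, since its factor at 1 is
  free.\<close>

lemma code_sum_mult_T_D: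
  assumes "\<tau> \<in> B_group n" "t \<in> T_D n"
  shows "code_sum reflection_weight n (\<tau> \<circ> t) \<le> code_sum reflection_weight n \<tau> + 1"
  using assms(2)
proof (cases rule: T_D_cases)
  case (1 i j)
  then show ?thesis
    using code_sum_mult_reflection[OF assms(1) 1(1)] reflection_weight_le[of i j]
    unfolding 1(2) by linarith
next
  case (2 i)
  have "\<tau> \<circ> reflection (- i) i \<in> B_group n"
    using assms(1) 2(1) by (intro B_group_comp reflection_TB_in_B_group)
  then have "code_sum reflection_weight n (\<tau> \<circ> reflection (- i) i \<circ> sign_one)
      \<le> code_sum reflection_weight n (\<tau> \<circ> reflection (- i) i) + reflection_weight (- 1) 1"
    using 2(2) by (rule code_sum_mult_reflection)
  moreover have "code_sum reflection_weight n (\<tau> \<circ> reflection (- i) i)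
      \<le> code_sum reflection_weight n \<tau> + reflection_weight (- i) i"
    using assms(1) 2(1) by (rule code_sum_mult_reflection)
  moreover have "reflection_weight (- 1) 1 = 0" by (simp add: reflection_weight_def)
  ultimately show ?thesis
    unfolding 2(3) comp_assoc[symmetric] using reflection_weight_le[of "- i" i] by linarith
qed

lemma code_sum_le_length:
  "set ts \<subseteq> T_D n \<Longrightarrow> code_sum reflection_weight n (prod_comp ts) \<le> length ts"
proof (induction ts rule: rev_induct)
  case (snoc t ts)
  have "prod_comp ts \<in> B_group n"
    using snoc.prems T_D_in_B_group by (intro prod_comp_in_B_group) auto
  then have "code_sum reflection_weight n (prod_comp ts \<circ> t)
      \<le> code_sum reflection_weight n (prod_comp ts) + 1"
    using snoc.prems by (intro code_sum_mult_T_D) auto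
  moreover have "code_sum reflection_weight n (prod_comp ts) \<le> length ts"
    using snoc by simp
  moreover have eq: "prod_comp (ts @ [t]) = prod_comp ts \<circ> t" "length (ts @ [t]) = length ts + 1"
    by (simp_all add: prod_comp_append)
  ultimately show ?case unfolding eq by linarith
qed simp

section \<open>Parity of the factors and upper bound for the length\<close>

lemma bsign_reflection:
  assumes "x \<in> signed_points n"
  shows "bsign (Suc n) (reflection x (int (Suc n))) = 1"
proof -
  let ?N = "int (Suc n)"
  have pos: "bsign (Suc n) (reflection p ?N) = 1" if "0 < p" "p < ?N" for p
    unfolding bsign_def by (rule prod.neutral) (use that in \<open>auto simp: reflection_def\<close>)
  show ?thesis
  proof (cases "x > 0")
    case True
    then show ?thesis using pos assms by auto
  next
    case False
    \<comment> \<open>The sign change at |x| conjugates the reflection to the one with positive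
      label -x, and conjugate elements have equal sign.\<close>
    let ?e = "reflection x (- x)"
    have e: "?e \<in> B_group (Suc n)" using assms by (intro reflection_in_B_group) auto
    have r: "reflection (- x) ?N \<in> B_group (Suc n)" "reflection x ?N \<in> B_group (Suc n)"
      using assms by (auto intro!: reflection_in_B_group)
    have "?e ?N = ?N" using assms by (auto simp: reflection_def)
    then have "?e \<circ> reflection (- x) ?N = reflection x ?N \<circ> ?e"
      using B_group_conj_reflection[OF e, of "- x" ?N] by simp
    then have "bsign (Suc n) ?e * bsign (Suc n) (reflection (- x) ?N)
        = bsign (Suc n) (reflection x ?N) * bsign (Suc n) ?e"
      using bsign_comp e r by metis
    then show ?thesis using pos[of "- x"] False assms bsign_cases[OF e] by auto
  qed
qed

lemma bsign_sign_last: "bsign (Suc n) (reflection (- int (Suc n)) (int (Suc n))) = - 1"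
proof -
  have "{1..int (Suc n)} = insert (int (Suc n)) {1..int n}" by auto
  moreover have "(\<Prod>i\<in>{1..int n}. sgn (reflection (- int (Suc n)) (int (Suc n)) i)) = 1"
    by (rule prod.neutral) (auto simp: reflection_def)
  ultimately show ?thesis unfolding bsign_def by simp
qed

text \<open>Only a last factor (-(n+1), n+1) is odd and lies outside \<open>T_D\<close>. In that
  case a sign change at 1 is borrowed from the rest of the product, at no cost in weight.\<close>

lemma T_D_factorization_exists:
  "\<sigma> \<in> D_group n \<Longrightarrow>
    \<exists>ts. set ts \<subseteq> T_D n \<and> prod_comp ts = \<sigma> \<and> length ts \<le> code_sum reflection_weight n \<sigma>"
proof (induction n arbitrary: \<sigma>)
  case 0
  then have "\<sigma> = id" by (simp add: D_group_iff B_group_0)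
  then show ?case by (intro exI[of _ "[]"]) simp
next
  case (Suc n)
  let ?N = "int (Suc n)"
  have B: "\<sigma> \<in> B_group (Suc n)" and sg: "bsign (Suc n) \<sigma> = 1"
    using Suc.prems by (auto simp: D_group_iff)
  obtain \<rho> x where \<rho>: "\<rho> \<in> B_group n" and x: "x \<in> signed_points (Suc n)"
    and \<sigma>: "\<sigma> = \<rho> \<circ> reflection x ?N"
    using B_group_Suc_cases[OF B] .
  note code = code_sum_comp_reflection[OF \<rho> x, of reflection_weight, folded \<sigma>]
  have rB: "reflection x ?N \<in> B_group (Suc n)" using x by (intro reflection_in_B_group) auto
  have sg': "bsign n \<rho> * bsign (Suc n) (reflection x ?N) = 1"
    using sg unfolding \<sigma> bsign_comp[OF B_group_Suc[OF \<rho>] rB] bsign_Suc[OF \<rho>] .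
  consider "x = ?N" | "x \<noteq> ?N" "x \<noteq> - ?N" | "x = - ?N" by blast
  then show ?case
  proof cases
    case 1
    then have "\<rho> = \<sigma>" "bsign n \<rho> = 1" using \<sigma> sg' by auto
    then obtain ts where "set ts \<subseteq> T_D n" "prod_comp ts = \<sigma>"
      "length ts \<le> code_sum reflection_weight n \<rho>"
      using Suc.IH[of \<rho>] \<rho> by (auto simp: D_group_iff)
    moreover have "code_sum reflection_weight (Suc n) \<sigma> = code_sum reflection_weight n \<rho>"
      unfolding code using 1 by simp
    ultimately show ?thesis using T_D_Suc by (metis order_trans)
  next
    case 2
    then have x': "x \<in> signed_points n" using x by auto
    then have "bsign n \<rho> = 1" using sg' bsign_reflection[of x n] by auto
    then obtain ts where ts: "set ts \<subseteq> T_D n" "prod_comp ts = \<rho>"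
      "length ts \<le> code_sum reflection_weight n \<rho>"
      using Suc.IH[of \<rho>] \<rho> by (auto simp: D_group_iff)
    have "reflection x ?N \<in> T_D (Suc n)"
      unfolding T_D_def using x' by (intro UnI1 CollectI exI[of _ x] exI[of _ ?N]) auto
    then have "set (ts @ [reflection x ?N]) \<subseteq> T_D (Suc n)" using ts(1) T_D_Suc by auto
    moreover have "prod_comp (ts @ [reflection x ?N]) = \<sigma>"
      using ts(2) by (simp add: prod_comp_append \<sigma>)
    moreover have "reflection_weight x ?N = 1" using x' by (auto simp: reflection_weight_def)
    then have "length (ts @ [reflection x ?N]) \<le> code_sum reflection_weight (Suc n) \<sigma>"
      unfolding code using ts(3) 2(1) by simp
    ultimately show ?thesis by blast
  next
    case 3
    \<comment> \<open>Oddness of \<rho> forces n >= 1. Then \<open>\<rho> \<circ> sign_one\<close>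
      is even, and the compensating \<open>sign_one\<close> is absorbed into the generator
      \<open>?t\<close>, with which it commutes.\<close>
    have sgn\<rho>: "bsign n \<rho> = - 1" using sg' bsign_sign_last[of n] 3 by simp
    then have n: "n \<ge> 1" by (cases n) (auto simp: bsign_def)
    note e = sign_one_in_B_group[OF n]
    have L: "(- 1, 1) \<in> TB_labels n" using n by (auto simp: TB_labels_iff)
    have "\<rho> \<circ> sign_one \<in> D_group n"
      using \<rho> e sgn\<rho> bsign_sign_one[OF n] by (simp add: D_group_iff B_group_comp bsign_comp)
    then obtain ts where ts: "set ts \<subseteq> T_D n" "prod_comp ts = \<rho> \<circ> sign_one"
      "length ts \<le> code_sum reflection_weight n (\<rho> \<circ> sign_one)"
      using Suc.IH by blast
    let ?t = "reflection (- ?N) ?N \<circ> sign_one"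
    have "?t \<in> T_D (Suc n)"
      unfolding T_D_def using n by (intro UnI2 CollectI exI[of _ ?N]) auto
    moreover have "prod_comp (ts @ [?t]) = \<sigma>"
    proof -
      have "sign_one \<circ> reflection (- ?N) ?N = ?t"
        using n by (auto simp: B_group_conj_reflection[OF e] sign_one_apply)
      then have "sign_one \<circ> ?t = reflection (- ?N) ?N"
        by (metis comp_assoc id_comp sign_one_idem)
      then show ?thesis unfolding \<sigma> 3 by (simp only: prod_comp_append ts(2) prod_comp_Cons prod_comp_Nil comp_id comp_assoc)
    qed
    moreover have "length ts \<le> code_sum reflection_weight n \<rho>"
      using ts(3) code_sum_mult_reflection[OF \<rho> L] by (simp add: reflection_weight_def)
    then have "length (ts @ [?t]) \<le> code_sum reflection_weight (Suc n) \<sigma>"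
      unfolding code using 3 n by (simp add: reflection_weight_def)
    ultimately show ?thesis using ts(1) T_D_Suc by (intro exI[of _ "ts @ [?t]"]) auto
  qed
qed

lemma length_D_eq_code_sum:
  assumes "\<sigma> \<in> D_group n"
  shows "length_D n \<sigma> = code_sum reflection_weight n \<sigma>"
proof -
  obtain ts where ts: "set ts \<subseteq> T_D n" "prod_comp ts = \<sigma>"
    "length ts \<le> code_sum reflection_weight n \<sigma>"
    using T_D_factorization_exists[OF assms] by blast
  have "length ts = code_sum reflection_weight n \<sigma>"
    using ts(3) code_sum_le_length[OF ts(1)] unfolding ts(2) by (rule antisym)
  show ?thesis
    unfolding length_D_def
  proof (rule Least_equality)
    show "\<exists>us. length us = code_sum reflection_weight n \<sigma> \<and> set us \<subseteq> T_D n \<and> prod_comp us = \<sigma>"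
      using ts(1,2) \<open>length ts = _\<close> by blast
  next
    fix k assume "\<exists>us. length us = k \<and> set us \<subseteq> T_D n \<and> prod_comp us = \<sigma>"
    then obtain us where "length us = k" "set us \<subseteq> T_D n" "prod_comp us = \<sigma>" by blast
    then show "code_sum reflection_weight n \<sigma> \<le> k" using code_sum_le_length[of us n] by simp
  qed
qed

section \<open>Equidistribution and the generating function\<close>

text \<open>The right side does not mention \<open>c\<close>: whichever transversal builds D_(n+1),
  the increments are the same, and this is the whole comparison of the two pairs.\<close>

lemma sum_D_group_recursion:
  fixes A L :: "nat \<Rightarrow> (int \<Rightarrow> int) \<Rightarrow> nat" and f :: "nat \<Rightarrow> nat \<Rightarrow> 'b::comm_monoid_add"
  assumes n: "n \<ge> 1"
    and c: "\<And>x. x \<in> signed_points (Suc n) \<Longrightarrow> c x \<in> B_group (Suc n) \<and> c x x = int (Suc n)"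
    and flip: "\<And>\<tau>. \<tau> \<in> B_group (Suc n) \<Longrightarrow>
      A (Suc n) (sign_one \<circ> \<tau>) = A (Suc n) \<tau> \<and> L (Suc n) (sign_one \<circ> \<tau>) = L (Suc n) \<tau>"
    and step: "\<And>\<sigma> x. \<sigma> \<in> B_group n \<Longrightarrow> x \<in> signed_points (Suc n) \<Longrightarrow>
      A (Suc n) (\<sigma> \<circ> c x) = A n \<sigma> + letter_weight x (int (Suc n)) \<and>
      L (Suc n) (\<sigma> \<circ> c x) = L n \<sigma> + of_bool (x \<noteq> int (Suc n))"
  shows "(\<Sum>\<tau>\<in>D_group (Suc n). f (A (Suc n) \<tau>) (L (Suc n) \<tau>)) =
    (\<Sum>\<sigma>\<in>D_group n. \<Sum>x\<in>signed_points (Suc n).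
      f (A n \<sigma> + letter_weight x (int (Suc n))) (L n \<sigma> + of_bool (x \<noteq> int (Suc n))))"
proof -
  have "(\<Sum>\<tau>\<in>D_group (Suc n). f (A (Suc n) \<tau>) (L (Suc n) \<tau>)) =
    (\<Sum>x\<in>signed_points (Suc n). \<Sum>\<sigma>\<in>D_group n. f (A (Suc n) (\<sigma> \<circ> c x)) (L (Suc n) (\<sigma> \<circ> c x)))"
    by (rule sum_D_group_Suc[OF n c]) (simp_all only: flip)
  also have "\<dots> = (\<Sum>x\<in>signed_points (Suc n). \<Sum>\<sigma>\<in>D_group n.
      f (A n \<sigma> + letter_weight x (int (Suc n))) (L n \<sigma> + of_bool (x \<noteq> int (Suc n))))"
    by (intro sum.cong refl) (simp only: step D_group_iff)
  also have "\<dots> = (\<Sum>\<sigma>\<in>D_group n. \<Sum>x\<in>signed_points (Suc n).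
      f (A n \<sigma> + letter_weight x (int (Suc n))) (L n \<sigma> + of_bool (x \<noteq> int (Suc n))))"
    by (rule sum.swap)
  finally show ?thesis .
qed

lemma sum_inv_nmin_Suc:
  fixes f :: "nat \<Rightarrow> nat \<Rightarrow> 'b::comm_monoid_add"
  assumes "n \<ge> 1"
  shows "(\<Sum>\<tau>\<in>D_group (Suc n). f (inv_D (Suc n) \<tau>) (nmin_D (Suc n) \<tau>)) =
    (\<Sum>\<sigma>\<in>D_group n. \<Sum>x\<in>signed_points (Suc n).
      f (inv_D n \<sigma> + letter_weight x (int (Suc n))) (nmin_D n \<sigma> + of_bool (x \<noteq> int (Suc n))))"
proof (rule sum_D_group_recursion[OF assms])
  fix x assume x: "x \<in> signed_points (Suc n)"
  show "insertion_cycle n x \<in> B_group (Suc n) \<and> insertion_cycle n x x = int (Suc n)"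
    using insertion_cycle_in_B_group[OF x] insertion_cycle_apply(1)[OF x id_in_B_group] by blast
  fix \<sigma> assume \<sigma>: "\<sigma> \<in> B_group n"
  show "inv_D (Suc n) (\<sigma> \<circ> insertion_cycle n x) = inv_D n \<sigma> + letter_weight x (int (Suc n)) \<and>
    nmin_D (Suc n) (\<sigma> \<circ> insertion_cycle n x) = nmin_D n \<sigma> + of_bool (x \<noteq> int (Suc n))"
    using inv_D_insertion[OF x \<sigma>] nmin_D_insertion[OF x \<sigma> assms] by blast
qed (use inv_D_sign_one nmin_D_sign_one in blast)

lemma sum_sor_length_Suc:
  fixes f :: "nat \<Rightarrow> nat \<Rightarrow> 'b::comm_monoid_add"
  assumes n: "n \<ge> 1"
  shows "(\<Sum>\<tau>\<in>D_group (Suc n). f (sor_D (Suc n) \<tau>) (length_D (Suc n) \<tau>)) =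
    (\<Sum>\<sigma>\<in>D_group n. \<Sum>x\<in>signed_points (Suc n).
      f (sor_D n \<sigma> + letter_weight x (int (Suc n))) (length_D n \<sigma> + of_bool (x \<noteq> int (Suc n))))"
proof -
  let ?A = "code_sum letter_weight" and ?L = "code_sum reflection_weight" and ?N = "int (Suc n)"
  have "(\<Sum>\<tau>\<in>D_group (Suc n). f (?A (Suc n) \<tau>) (?L (Suc n) \<tau>)) =
    (\<Sum>\<sigma>\<in>D_group n. \<Sum>x\<in>signed_points (Suc n).
      f (?A n \<sigma> + letter_weight x ?N) (?L n \<sigma> + of_bool (x \<noteq> ?N)))"
  proof (rule sum_D_group_recursion[OF n])
    fix x assume x: "x \<in> signed_points (Suc n)"
    show "reflection x ?N \<in> B_group (Suc n) \<and> reflection x ?N x = ?N"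
      using reflection_in_B_group[OF x, of ?N] by simp
    fix \<sigma> assume \<sigma>: "\<sigma> \<in> B_group n"
    have "letter_weight ?N ?N = 0" by (simp add: letter_weight_def)
    moreover have "reflection_weight x ?N = 1" using n by (simp add: reflection_weight_def)
    ultimately show "?A (Suc n) (\<sigma> \<circ> reflection x ?N) = ?A n \<sigma> + letter_weight x ?N \<and>
      ?L (Suc n) (\<sigma> \<circ> reflection x ?N) = ?L n \<sigma> + of_bool (x \<noteq> ?N)"
      unfolding code_sum_comp_reflection[OF \<sigma> x] by simp
  next
    fix \<tau> assume "\<tau> \<in> B_group (Suc n)"
    then show "?A (Suc n) (sign_one \<circ> \<tau>) = ?A (Suc n) \<tau> \<and> ?L (Suc n) (sign_one \<circ> \<tau>) = ?L (Suc n) \<tau>"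
      by (intro conjI code_sum_sign_one) (simp_all add: letter_weight_def reflection_weight_def)
  qed
  moreover have "sor_D m \<tau> = ?A m \<tau>" "length_D m \<tau> = ?L m \<tau>" if "\<tau> \<in> D_group m" for m \<tau>
    using that length_D_eq_code_sum by (auto simp: D_group_iff sor_D_eq_code_sum)
  ultimately show ?thesis by simp
qed

lemma sum_D_group_1: "(\<Sum>\<sigma>\<in>D_group 1. g \<sigma>) = (g id :: 'b::comm_monoid_add)"
  by (simp only: D_group_1 sum.insert sum.empty finite.emptyI empty_iff not_False_eq_True add_0_right)

lemma sor_D_id: "sor_D n id = 0"
  by (simp only: sor_D_eq_code_sum id_in_B_group code_sum_id)

lemma length_D_id: "length_D n id = 0"
proof -
  have "id \<in> D_group n" unfolding D_group_iff by (simp only: id_in_B_group bsign_id)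
  then show ?thesis by (simp only: length_D_eq_code_sum code_sum_id)
qed

lemma sum_D_group_equidistributed:
  fixes f :: "nat \<Rightarrow> nat \<Rightarrow> 'b::comm_monoid_add"
  assumes "n \<ge> 1"
  shows "(\<Sum>\<sigma>\<in>D_group n. f (inv_D n \<sigma>) (nmin_D n \<sigma>)) = (\<Sum>\<sigma>\<in>D_group n. f (sor_D n \<sigma>) (length_D n \<sigma>))"
  using assms
proof (induction n arbitrary: f rule: dec_induct)
  case base
  show ?case unfolding sum_D_group_1 inv_D_id nmin_D_id sor_D_id length_D_id ..
next
  case (step n)
  show ?case
    unfolding sum_inv_nmin_Suc[OF step.hyps(1)] sum_sor_length_Suc[OF step.hyps(1)]
    \<comment> \<open>The inductive hypothesis is applied to the function of (a, b) that sums
      \<open>f\<close> at the shifted arguments over all x, hence the generalization over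
      \<open>f\<close>.\<close>
    by (rule step.IH)
qed

lemma letter_sum:
  fixes q t :: "'a::comm_ring_1"
  shows "(\<Sum>x\<in>signed_points (Suc n). q ^ letter_weight x (int (Suc n)) * t ^ of_bool (x \<noteq> int (Suc n)))
    = 1 + q ^ n * t + q * t * q_int (2 * n) q"
proof -
  let ?N = "int (Suc n)"
  let ?h = "\<lambda>x. q ^ letter_weight x ?N * t ^ of_bool (x \<noteq> ?N)"
  \<comment> \<open>Index k lists the point of weight k+1: the points n, ..., 1 for k < n, then -2,
    ..., -(n+1). The omitted point -1 has weight n, the same as the point 1, and is the source of
    the separate term q^n t.\<close>
  let ?g = "\<lambda>k. if k < n then int n - int k else int n - int k - 2"
  define G where "G = ?g ` {..<2 * n}"
  have "x \<in> G" if "x \<in> signed_points (Suc n)" "x \<noteq> ?N" "x \<noteq> - 1" for x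
    unfolding G_def using that by (intro image_eqI[of _ _ "nat (if x > 0 then int n - x else int n - x - 2)"]) auto
  moreover have "G \<subseteq> signed_points (Suc n)" by (auto simp: G_def)
  moreover have "?N \<in> signed_points (Suc n)" "- 1 \<in> signed_points (Suc n)" by auto
  ultimately have "signed_points (Suc n) = insert ?N (insert (- 1) G)" by blast
  moreover have "- 1 \<notin> G" "?N \<notin> insert (- 1) G" "finite G"
    by (auto simp: G_def split: if_splits)
  ultimately have "(\<Sum>x\<in>signed_points (Suc n). ?h x) = ?h ?N + (?h (- 1) + (\<Sum>x\<in>G. ?h x))"
    by (simp only: sum.insert finite_insert not_False_eq_True)
  also have "?h ?N = 1" by (simp add: letter_weight_def)
  also have "?h (- 1) = q ^ n * t" by (simp add: letter_weight_def)
  also have "(\<Sum>x\<in>G. ?h x) = (\<Sum>k<2 * n. ?h (?g k))"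
    unfolding G_def by (rule sum.reindex_cong[OF _ refl refl]) (auto simp: inj_on_def split: if_splits)
  also have "\<dots> = (\<Sum>k<2 * n. q * t * q ^ k)"
  proof (rule sum.cong[OF refl])
    fix k assume "k \<in> {..<2 * n}"
    have "letter_weight (?g k) ?N = Suc k" by (auto simp: letter_weight_def)
    moreover have "?g k \<noteq> ?N" by auto
    ultimately show "?h (?g k) = q * t * q ^ k" by (simp only: of_bool_eq) (simp add: mult_ac)
  qed
  also have "\<dots> = q * t * q_int (2 * n) q" by (simp add: q_int_def sum_distrib_left)
  finally show ?thesis by (simp add: add.assoc)
qed

lemma sum_sor_length_eq_prod:
  fixes q t :: "'a::comm_ring_1"
  assumes "n \<ge> 1"
  shows "(\<Sum>\<sigma>\<in>D_group n. q ^ sor_D n \<sigma> * t ^ length_D n \<sigma>) =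
    (\<Prod>r = 1..n - 1. 1 + q ^ r * t + q * t * q_int (2 * r) q)"
  using assms
proof (induction n rule: dec_induct)
  case base
  show ?case unfolding sum_D_group_1 sor_D_id length_D_id by simp
next
  case (step n)
  let ?w = "\<lambda>x. q ^ letter_weight x (int (Suc n)) * t ^ of_bool (x \<noteq> int (Suc n))"
  have "(\<Sum>\<sigma>\<in>D_group (Suc n). q ^ sor_D (Suc n) \<sigma> * t ^ length_D (Suc n) \<sigma>) =
    (\<Sum>\<sigma>\<in>D_group n. \<Sum>x\<in>signed_points (Suc n). (q ^ sor_D n \<sigma> * t ^ length_D n \<sigma>) * ?w x)"
    unfolding sum_sor_length_Suc[OF step.hyps(1), of "\<lambda>a b. q ^ a * t ^ b"]
    by (intro sum.cong refl) (simp only: power_add mult_ac)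
  also have "\<dots> = (\<Sum>\<sigma>\<in>D_group n. q ^ sor_D n \<sigma> * t ^ length_D n \<sigma>) * (\<Sum>x\<in>signed_points (Suc n). ?w x)"
    by (rule sum_product[symmetric])
  also have "\<dots> = (\<Prod>r = 1..n - 1. 1 + q ^ r * t + q * t * q_int (2 * r) q)
      * (1 + q ^ n * t + q * t * q_int (2 * n) q)"
    unfolding step.IH letter_sum ..
  also have "\<dots> = (\<Prod>r = 1..Suc n - 1. 1 + q ^ r * t + q * t * q_int (2 * r) q)"
    using step.hyps(1) by (cases n) simp_all
  finally show ?case .
qed

theorem theorem4p2:
  fixes n :: nat and q t :: "'a::comm_ring_1"
  assumes "n \<ge> 2"
  shows "equidistributed_on (D_group n)
           (\<lambda>\<sigma>. (inv_D n \<sigma>, nmin_D n \<sigma>)) (\<lambda>\<sigma>. (sor_D n \<sigma>, length_D n \<sigma>)) \<and>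
         (\<Sum>\<sigma>\<in>D_group n. q ^ inv_D n \<sigma> * t ^ nmin_D n \<sigma>) =
           (\<Sum>\<sigma>\<in>D_group n. q ^ sor_D n \<sigma> * t ^ length_D n \<sigma>) \<and>
         (\<Sum>\<sigma>\<in>D_group n. q ^ sor_D n \<sigma> * t ^ length_D n \<sigma>) =
           (\<Prod>r = 1..n - 1. 1 + q ^ r * t + q * t * q_int (2 * r) q)"
proof (intro conjI)
  have n: "n \<ge> 1" using assms by simp
  \<comment> \<open>A fibre size is a sum of indicators, so equidistribution becomes an instance of
    the identity for arbitrary \<open>f\<close>.\<close>
  have card: "card {\<sigma> \<in> D_group n. g \<sigma> = v} = (\<Sum>\<sigma>\<in>D_group n. of_bool (g \<sigma> = v))"
    for g :: "_ \<Rightarrow> nat \<times> nat" and v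
    by (simp add: finite_D_group of_bool_def sum.If_cases Int_def)
  show "equidistributed_on (D_group n)
      (\<lambda>\<sigma>. (inv_D n \<sigma>, nmin_D n \<sigma>)) (\<lambda>\<sigma>. (sor_D n \<sigma>, length_D n \<sigma>))"
    unfolding equidistributed_on_def card
    using sum_D_group_equidistributed[OF n, of "\<lambda>a b. of_bool ((a, b) = _)"] by blast
  show "(\<Sum>\<sigma>\<in>D_group n. q ^ inv_D n \<sigma> * t ^ nmin_D n \<sigma>) =
      (\<Sum>\<sigma>\<in>D_group n. q ^ sor_D n \<sigma> * t ^ length_D n \<sigma>)"
    using sum_D_group_equidistributed[OF n, of "\<lambda>a b. q ^ a * t ^ b"] .
  show "(\<Sum>\<sigma>\<in>D_group n. q ^ sor_D n \<sigma> * t ^ length_D n \<sigma>) =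
      (\<Prod>r = 1..n - 1. 1 + q ^ r * t + q * t * q_int (2 * r) q)"
    using sum_sor_length_eq_prod[OF n] .
qed

end
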